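(* Let $\phi=\oplus_{i\in{\rm Supp}(\phi)}(Q_i\odot Y^i)$ be a polyhedral polynomial, let $M$ be the Minkowski sum of its coefficients and let $V(M)$ be the set of vertices of $M$. Then $\phi$ has a global solution if and only if for each vertex $v$ of $M$ there is a complete $v$-local solution $S_v$ such that, with $P_0:={\rm CH}(\cup_{v\in V(M)}V(S_v))$ (${\rm CH}$ denoting convex hull and $V(\cdot)$ the vertex set), the following property holds: (P) for every $v\in V(M)$ and every vertex $\gamma$ of $P_0$, if $N_M(v)\cap N_{P_0}(\gamma)$ is full-dimensional, then $\gamma$ is a vertex of $S_v$. Furthermore, (when such $S_v$ exist) the polytope $P_0$ is a global solution to $\phi$.
   Context: Fix $n\ge 1$ and $\omega\in(\mathbb{R}^n)^\star$ whose coordinates are linearly independent over $\mathbb{Q}$. A nonempty polyhedron $P\subset\mathbb{R}^n$ is $\omega$-positive if $\min_{x\in P}\omega(x)$ exists. $\mathcal{P}_\omega$ is the semiring of all $\omega$-positive rational polyhedra together with an extra element $0$, with addition $\oplus$ = (closed) convex hull of the union, multiplication $\odot$ = Minkowski sum, $P\oplus 0=P$, $P\odot 0=0$. A polyhedral semiring $\mathcal{A}$ is a semiring with additive and multiplicative identity embedded as a sub-semiring in some $\mathcal{P}_\omega$. A polyhedral polynomial is $\phi=\oplus_{i\in{\rm Supp}(\phi)}(Q_i\odot Y^i)$ with ${\rm Supp}(\phi)\subset\mathbb{Z}_{\ge0}$ finite with at least two elements and $Q_i\in\mathcal{A}\setminus\{0\}$. $M:=\odot_iQ_i$. For a polyhedron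 $P$ and a vertex $\gamma$ of $P$, $N_P(\gamma)=\{\ell\in(\mathbb{R}^n)^\star:\ell(\gamma)\le\ell(x)\ \forall x\in P\}$ is the inner normal cone, and $N(P)$, the support of $P$, is the union of the inner normal cones of all vertices of $P$. For a polyhedron $P$ (having at least one vertex), $\phi(P)=\oplus_i(Q_i\odot P^{\odot i})$, where $P^{\odot i}$ is the $i$-fold Minkowski sum and $Q_0\odot P^{\odot0}=Q_0$. $P$ is a solution to $\phi$ if every vertex of $\phi(P)$ is a vertex of at least two distinct summands $Q_i\odot P^{\odot i}$. For a vertex $v$ of $M$, a solution $P$ is $v$-local if $N(P)\subseteq N_M(v)$; a $v$-local solution is complete if $N(P)=N_M(v)$. A solution $P$ is a global solution if $N(P)\supseteq N(M)$. *)

theory Defs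
  imports "HOL-Analysis.Analysis" "HOL-Library.Set_Algebras"
begin

text \<open>
  Linear functionals on \<open>real ^ 'n\<close> are identified with vectors through the inner product.
  Minkowski sums are the operations \<open>+\<close> and \<open>\<Sum>\<close> on sets provided by
  \<open>Set_Algebras\<close>, where the set \<open>0\<close> is the singleton of the origin. The adjoined zero
  element of the semirings below is represented by the empty set: the elements other than zero are
  nonempty closed convex sets, so the empty set is neutral for the closed convex hull of the union
  and absorbing for Minkowski sum.
\<close>

definition rationally_independent :: "real ^ 'n \<Rightarrow> bool" where
  "rationally_independent \<omega> \<longleftrightarrow>
     (\<forall>q :: 'n \<Rightarrow> rat. (\<Sum>i\<in>UNIV. of_rat (q i) * \<omega> $ i) = 0 \<longrightarrow> (\<forall>i. q i = 0))"

definition rational_polyhedron :: "(real ^ 'n) set \<Rightarrow> bool" where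
  "rational_polyhedron P \<longleftrightarrow>
     (\<exists>F. finite F \<and> P = \<Inter>F \<and>
          (\<forall>h\<in>F. \<exists>a b. a \<noteq> 0 \<and> (\<forall>i. a $ i \<in> \<rat>) \<and> b \<in> \<rat> \<and> h = {x. a \<bullet> x \<le> b}))"

definition omega_positive :: "real ^ 'n \<Rightarrow> (real ^ 'n) set \<Rightarrow> bool" where
  "omega_positive \<omega> P \<longleftrightarrow> (\<exists>x\<in>P. \<forall>y\<in>P. \<omega> \<bullet> x \<le> \<omega> \<bullet> y)"

definition positive_polyhedra :: "real ^ 'n \<Rightarrow> (real ^ 'n) set set" where
  "positive_polyhedra \<omega> = insert {} {P. rational_polyhedron P \<and> P \<noteq> {} \<and> omega_positive \<omega> P}"

definition hull_Sum :: "'i set \<Rightarrow> ('i \<Rightarrow> (real ^ 'n) set) \<Rightarrow> (real ^ 'n) set" where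
  "hull_Sum I F = closure (convex hull (\<Union>i\<in>I. F i))"

definition hull_add :: "(real ^ 'n) set \<Rightarrow> (real ^ 'n) set \<Rightarrow> (real ^ 'n) set" where
  "hull_add P Q = closure (convex hull (P \<union> Q))"

lemma hull_Sum_insert: "hull_Sum (insert i I) F = hull_add (F i) (hull_Sum I F)"
proof -
  let ?U = "\<Union>j\<in>I. F j"
  let ?R = "closure (convex hull (F i \<union> ?U))"
  have "closure (convex hull ?U) \<subseteq> ?R"
    by (intro closure_mono hull_mono) auto
  moreover have "F i \<subseteq> ?R"
    by (meson Un_upper1 closure_subset hull_subset order_trans)
  ultimately have "convex hull (F i \<union> closure (convex hull ?U)) \<subseteq> ?R"
    by (intro hull_minimal) (auto simp: convex_closure)
  then have "closure (convex hull (F i \<union> closure (convex hull ?U))) \<subseteq> ?R"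
    by (simp add: closure_minimal)
  moreover have "F i \<union> ?U \<subseteq> F i \<union> closure (convex hull ?U)"
    by (meson Un_mono closure_subset hull_subset order_refl order_trans)
  then have "?R \<subseteq> closure (convex hull (F i \<union> closure (convex hull ?U)))"
    by (intro closure_mono hull_mono)
  ultimately show ?thesis
    by (simp add: hull_Sum_def hull_add_def)
qed

text \<open>
  The multiplicative identity of a polyhedral semiring need not be that of the ambient semiring:
  the polyhedra with a fixed recession cone have this cone as identity.
\<close>

definition polyhedral_semiring :: "real ^ 'n \<Rightarrow> (real ^ 'n) set set \<Rightarrow> bool" where
  "polyhedral_semiring \<omega> A \<longleftrightarrow>
     A \<subseteq> positive_polyhedra \<omega> \<and> {} \<in> A \<and>
     (\<exists>e\<in>A. \<forall>P\<in>A. e + P = P) \<and>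
     (\<forall>P\<in>A. \<forall>Q\<in>A. hull_add P Q \<in> A \<and> P + Q \<in> A)"

text \<open>
  A polyhedral polynomial is given by its coefficient function, with the zero element (the empty
  set) outside the support.
\<close>

definition Supp :: "(nat \<Rightarrow> (real ^ 'n) set) \<Rightarrow> nat set" where
  "Supp \<phi> = {i. \<phi> i \<noteq> {}}"

definition polyhedral_polynomial ::
  "(real ^ 'n) set set \<Rightarrow> (nat \<Rightarrow> (real ^ 'n) set) \<Rightarrow> bool" where
  "polyhedral_polynomial A \<phi> \<longleftrightarrow>
     (\<forall>i. \<phi> i \<in> A) \<and> finite (Supp \<phi>) \<and> 2 \<le> card (Supp \<phi>)"

definition coeff_sum :: "(nat \<Rightarrow> (real ^ 'n) set) \<Rightarrow> (real ^ 'n) set" where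
  "coeff_sum \<phi> = (\<Sum>i\<in>Supp \<phi>. \<phi> i)"

definition summand :: "(nat \<Rightarrow> (real ^ 'n) set) \<Rightarrow> (real ^ 'n) set \<Rightarrow> nat \<Rightarrow> (real ^ 'n) set" where
  "summand \<phi> P i = \<phi> i + (\<Sum>k<i. P)"

definition poly_value :: "(nat \<Rightarrow> (real ^ 'n) set) \<Rightarrow> (real ^ 'n) set \<Rightarrow> (real ^ 'n) set" where
  "poly_value \<phi> P = hull_Sum (Supp \<phi>) (summand \<phi> P)"

definition vertices :: "(real ^ 'n) set \<Rightarrow> (real ^ 'n) set" where
  "vertices P = {v. v extreme_point_of P}"

definition normal_cone :: "(real ^ 'n) set \<Rightarrow> real ^ 'n \<Rightarrow> (real ^ 'n) set" where
  "normal_cone P \<gamma> = {l. \<forall>x\<in>P. l \<bullet> \<gamma> \<le> l \<bullet> x}"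

definition normal_support :: "(real ^ 'n) set \<Rightarrow> (real ^ 'n) set" where
  "normal_support P = (\<Union>\<gamma>\<in>vertices P. normal_cone P \<gamma>)"

text \<open>
  The two summands at a vertex are required to be distinct as terms of the polynomial, that is, to
  have different exponents; as sets they may coincide.
\<close>

definition solution :: "(nat \<Rightarrow> (real ^ 'n) set) \<Rightarrow> (real ^ 'n) set \<Rightarrow> bool" where
  "solution \<phi> P \<longleftrightarrow>
     polyhedron P \<and> vertices P \<noteq> {} \<and>
     (\<forall>w\<in>vertices (poly_value \<phi> P).
        \<exists>i\<in>Supp \<phi>. \<exists>j\<in>Supp \<phi>. i \<noteq> j \<and>
          w \<in> vertices (summand \<phi> P i) \<and> w \<in> vertices (summand \<phi> P j))"

definition local_solution :: "(nat \<Rightarrow> (real ^ 'n) set) \<Rightarrow> real ^ 'n \<Rightarrow> (real ^ 'n) set \<Rightarrow> bool" where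
  "local_solution \<phi> v P \<longleftrightarrow> solution \<phi> P \<and> normal_support P \<subseteq> normal_cone (coeff_sum \<phi>) v"

definition complete_local_solution ::
  "(nat \<Rightarrow> (real ^ 'n) set) \<Rightarrow> real ^ 'n \<Rightarrow> (real ^ 'n) set \<Rightarrow> bool" where
  "complete_local_solution \<phi> v P \<longleftrightarrow>
     local_solution \<phi> v P \<and> normal_support P = normal_cone (coeff_sum \<phi>) v"

definition global_solution :: "(nat \<Rightarrow> (real ^ 'n) set) \<Rightarrow> (real ^ 'n) set \<Rightarrow> bool" where
  "global_solution \<phi> P \<longleftrightarrow> solution \<phi> P \<and> normal_support (coeff_sum \<phi>) \<subseteq> normal_support P"

definition full_dimensional :: "(real ^ 'n) set \<Rightarrow> bool" where
  "full_dimensional C \<longleftrightarrow> aff_dim C = int CARD('n)"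

definition glued :: "(nat \<Rightarrow> (real ^ 'n) set) \<Rightarrow> (real ^ 'n \<Rightarrow> (real ^ 'n) set) \<Rightarrow> (real ^ 'n) set" where
  "glued \<phi> S = convex hull (\<Union>v\<in>vertices (coeff_sum \<phi>). vertices (S v))"

definition compatible :: "(nat \<Rightarrow> (real ^ 'n) set) \<Rightarrow> (real ^ 'n \<Rightarrow> (real ^ 'n) set) \<Rightarrow> bool" where
  "compatible \<phi> S \<longleftrightarrow>
     (\<forall>v\<in>vertices (coeff_sum \<phi>). \<forall>\<gamma>\<in>vertices (glued \<phi> S).
        full_dimensional (normal_cone (coeff_sum \<phi>) v \<inter> normal_cone (glued \<phi> S) \<gamma>) \<longrightarrow>
        \<gamma> \<in> vertices (S v))"

end

theory Submission
  imports Defs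
begin

text \<open>
  By rational independence of \<open>\<omega>\<close>, all coefficients and \<open>M\<close> have vertices, so the support of their
  normal fans is the set of functionals bounded below. A vertex of a value \<open>\<phi>(P)\<close> is the unique
  minimiser of every functional in some nonempty open set; shrinking this set, one may assume that
  it selects a single vertex of each coefficient, of \<open>M\<close> and of \<open>P\<close>. Whether the vertex occurs in two
  summands then depends only on the vertex of \<open>P\<close> selected. Hence solutions may be compared
  direction by direction: property (P) says that \<open>P\<^sub>0\<close> and \<open>S\<^sub>v\<close> select the same vertex for generic
  functionals in \<open>N\<^sub>M(v)\<close>. Conversely, a global solution \<open>P\<close> is localised at \<open>v\<close> by adding the tangent cone
  of \<open>M\<close> at \<open>v\<close> to the convex hull of the vertices of \<open>P\<close>.
\<close>

section \<open>Rational linear relations and finite closed covers\<close>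

text \<open>Applying coordinatewise a \<open>\<rat>\<close>-linear map \<open>\<real> \<rightarrow> \<rat>\<close> that does not vanish on some coordinate of
  \<open>d\<close> preserves all rational linear relations.\<close>

lemma rational_common_orthogonal:
  fixes B :: "(real ^ 'n) set" and d :: "real ^ 'n"
  assumes rat: "\<And>a i. a \<in> B \<Longrightarrow> a $ i \<in> \<rat>" and orth: "\<And>a. a \<in> B \<Longrightarrow> a \<bullet> d = 0" and "d \<noteq> 0"
  obtains q :: "'n \<Rightarrow> rat" where "q \<noteq> (\<lambda>_. 0)" "\<And>a. a \<in> B \<Longrightarrow> a \<bullet> (\<chi> i. of_rat (q i)) = 0"
proof -
  interpret Q: vector_space_pair "\<lambda>(q::rat) (x::real). of_rat q * x" "\<lambda>(q::rat) (x::rat). q * x"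
    by unfold_locales (simp_all add: algebra_simps of_rat_add of_rat_mult)
  obtain k where k: "d $ k \<noteq> 0"
    using \<open>d \<noteq> 0\<close> by (auto simp: vec_eq_iff)
  \<comment> \<open>A nonzero real is independent over the rationals, so some rational-linear
    functional takes the value 1 on it. This keeps the image of \<open>d\<close> from
    vanishing.\<close>
  have "Q.vs1.independent {d $ k}"
    using k Q.vs1.independent_insert[of "d $ k" "{}"] Q.vs1.independent_empty by simp
  then obtain f where f: "Vector_Spaces.linear (\<lambda>(q::rat) (x::real). of_rat q * x) (\<lambda>(q::rat) (x::rat). q * x) f"
      "\<forall>x\<in>{d $ k}. f x = 1"
    using Q.linear_independent_extend[of "{d $ k}" "\<lambda>_. 1"] by blast
  interpret f: Vector_Spaces.linear "\<lambda>(q::rat) (x::real). of_rat q * x" "\<lambda>(q::rat) (x::rat). q * x" f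
    by (rule f(1))
  show ?thesis
  proof
    show "(\<lambda>i. f (d $ i)) \<noteq> (\<lambda>_. 0)"
      using f(2) by (metis singletonI zero_neq_one)
    fix a assume a: "a \<in> B"
    have "\<forall>i. \<exists>r. a $ i = of_rat r"
      using rat[OF a] by (auto simp: Rats_def)
    then obtain r where r: "\<And>i. a $ i = of_rat (r i)"
      by (auto dest: choice)
    \<comment> \<open>The entries of \<open>a\<close> are rational, so \<open>f\<close> passes
      through the linear relation and turns it into one between the values
      \<open>f (d $ i)\<close>.\<close>
    have "0 = f (a \<bullet> d)" using orth[OF a] f.zero by simp
    also have "\<dots> = (\<Sum>i\<in>UNIV. r i * f (d $ i))"
      by (simp add: inner_vec_def r f.sum f.scale)
    finally have "of_rat (\<Sum>i\<in>UNIV. r i * f (d $ i)) = (of_rat 0::real)" by (rule arg_cong[OF sym])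
    then show "a \<bullet> (\<chi> i. of_rat (f (d $ i))) = 0"
      by (simp add: inner_vec_def r of_rat_sum of_rat_mult)
  qed
qed

text \<open>A finite Baire argument: either one member contains all of \<open>U\<close>, or removing
  it leaves a nonempty open set that is covered by the remaining members.\<close>

lemma closed_finite_cover_open:
  assumes "finite I" "\<And>i. i \<in> I \<Longrightarrow> closed (N i)" "open U" "U \<noteq> {}" "U \<subseteq> (\<Union>i\<in>I. N i)"
  obtains i where "i \<in> I" "interior (U \<inter> N i) \<noteq> {}"
proof -
  have "\<exists>i\<in>I. interior (U \<inter> N i) \<noteq> {}"
    using assms
  proof (induction I arbitrary: U rule: finite_induct)
    case empty
    then show ?case by simp
  next
    case (insert j I)
    show ?case
    proof (cases "U \<subseteq> N j")
      case True
      with insert.prems show ?thesis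
        by (intro bexI[of _ j]) (auto simp: Int_absorb2 interior_open)
    next
      case False
      have "open (U - N j)"
        using insert.prems by (intro open_Diff) auto
      then have "\<exists>i\<in>I. interior ((U - N j) \<inter> N i) \<noteq> {}"
        by (rule insert.IH[rotated]) (use False insert.prems in auto)
      then obtain i where "i \<in> I" "interior ((U - N j) \<inter> N i) \<noteq> {}" by blast
      moreover have "interior ((U - N j) \<inter> N i) \<subseteq> interior (U \<inter> N i)"
        by (rule interior_mono) auto
      ultimately show ?thesis by blast
    qed
  qed
  then show ?thesis using that by blast
qed

text \<open>The members with nonempty interior form a closed union. A point of
  \<open>interior D\<close> outside it would have an open neighbourhood covered by the other
  members, which is impossible. Taking closures extends the cover from \<open>interior D\<close> to
  \<open>D\<close>.\<close>

lemma convex_finite_cover_full: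
  fixes N :: "'i \<Rightarrow> 'a::euclidean_space set"
  assumes "finite I" "\<And>i. i \<in> I \<Longrightarrow> closed (N i)" "convex D" "interior D \<noteq> {}"
    and cov: "D \<subseteq> (\<Union>i\<in>I. N i)"
  shows "D \<subseteq> (\<Union>i\<in>{i\<in>I. interior (N i) \<noteq> {}}. N i)" (is "_ \<subseteq> ?G")
proof -
  have "closed ?G"
    using assms by (intro closed_UN) auto
  have "interior D \<subseteq> ?G"
  proof (rule ccontr)
    assume "\<not> interior D \<subseteq> ?G"
    then have ne: "interior D - ?G \<noteq> {}" by blast
    have op: "open (interior D - ?G)"
      using \<open>closed ?G\<close> by (intro open_Diff) auto
    have sub: "interior D - ?G \<subseteq> (\<Union>i\<in>I. N i)"
      using cov interior_subset by blast
    obtain i where i: "i \<in> I" "interior ((interior D - ?G) \<inter> N i) \<noteq> {}"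
      by (rule closed_finite_cover_open[OF assms(1,2) op ne sub]) auto
    then have "interior (N i) \<noteq> {}"
      using interior_mono[of "(interior D - ?G) \<inter> N i" "N i"] by blast
    then show False
      using i interior_subset by blast
  qed
  then have "closure (interior D) \<subseteq> ?G"
    using \<open>closed ?G\<close> by (rule closure_minimal)
  then show ?thesis
    using convex_closure_interior[OF assms(3,4)] closure_subset by blast
qed

section \<open>Normal cones and vertices of polyhedra\<close>

lemma normal_cone_eq: "normal_cone P w = (\<Inter>x\<in>P. {l. 0 \<le> (x - w) \<bullet> l})"
  by (auto simp: normal_cone_def inner_diff inner_commute)

lemma closed_normal_cone: "closed (normal_cone P w)"
  unfolding normal_cone_eq by (intro closed_INT ballI closed_halfspace_ge)

lemma convex_normal_cone: "convex (normal_cone P w)"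
  unfolding normal_cone_eq by (intro convex_INT convex_halfspace_ge)

lemma zero_in_normal_cone: "0 \<in> normal_cone P w"
  by (simp add: normal_cone_def)

text \<open>If \<open>x\<close> tied with \<open>w\<close>, tilting \<open>l\<close> slightly
  against \<open>x - w\<close> would stay in the cone but make \<open>x\<close> strictly better than
  \<open>w\<close>.\<close>

lemma interior_normal_cone_unique:
  assumes l: "l \<in> interior (normal_cone P w)" and x: "x \<in> P" "l \<bullet> x \<le> l \<bullet> w"
  shows "x = w"
proof (rule ccontr)
  assume "x \<noteq> w"
  obtain e where e: "e > 0" "cball l e \<subseteq> normal_cone P w"
    using l by (auto simp: mem_interior_cball)
  let ?d = "(e / norm (x - w)) *\<^sub>R (x - w)"
  have "norm ?d = e" using \<open>x \<noteq> w\<close> e by simp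
  then have "l - ?d \<in> cball l e" by (simp add: dist_norm)
  then have "l - ?d \<in> normal_cone P w" using e by blast
  then have "(l - ?d) \<bullet> w \<le> (l - ?d) \<bullet> x"
    using x unfolding normal_cone_def by blast
  then have "?d \<bullet> (x - w) \<le> 0"
    using x by (simp add: algebra_simps)
  moreover have "?d \<bullet> (x - w) = e * norm (x - w)"
    by (simp add: power2_norm_eq_inner[symmetric] power2_eq_square)
  moreover have "e * norm (x - w) > 0"
    using \<open>x \<noteq> w\<close> e by simp
  ultimately show False by simp
qed

text \<open>An interior functional has \<open>w\<close> as its only minimiser, and a strict
  minimiser cannot lie inside a segment.\<close>

lemma vertex_if_interior_normal_cone:
  assumes "w \<in> P" "interior (normal_cone P w) \<noteq> {}"
  shows "w \<in> vertices P"
proof -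
  obtain l where l: "l \<in> interior (normal_cone P w)" using assms by blast
  have lw: "l \<bullet> w \<le> l \<bullet> x" if "x \<in> P" for x
    using l that interior_subset by (force simp: normal_cone_def)
  have "w \<notin> open_segment a b" if ab: "a \<in> P" "b \<in> P" for a b
  proof
    assume "w \<in> open_segment a b"
    then obtain u where u: "a \<noteq> b" "0 < u" "u < 1" "w = (1 - u) *\<^sub>R a + u *\<^sub>R b"
      by (auto simp: in_segment)
    have "w \<noteq> a" "w \<noteq> b" using \<open>w \<in> open_segment a b\<close> by (auto simp: open_segment_def)
    then have "l \<bullet> w < l \<bullet> a" "l \<bullet> w < l \<bullet> b"
      using interior_normal_cone_unique[OF l] ab by force+
    then have "(1 - u) * (l \<bullet> w) + u * (l \<bullet> w) < (1 - u) * (l \<bullet> a) + u * (l \<bullet> b)"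
      using u by (intro add_strict_mono mult_strict_left_mono) auto
    also have "\<dots> = l \<bullet> w" by (simp add: u(4) inner_add_right)
    finally show False by (simp add: algebra_simps)
  qed
  then show ?thesis
    using assms by (auto simp: vertices_def extreme_point_of_def)
qed

lemma vertex_midpoint:
  assumes "w \<in> vertices P" "a \<in> P" "b \<in> P" "2 *\<^sub>R w = a + b"
  shows "a = b"
proof (rule ccontr)
  assume "a \<noteq> b"
  have "w = (1/2) *\<^sub>R (2 *\<^sub>R w)" by simp
  also have "\<dots> = (1 - 1/2) *\<^sub>R a + (1/2) *\<^sub>R b"
    unfolding assms(4) by (simp add: scaleR_add_right)
  finally have "w \<in> open_segment a b"
    unfolding in_segment using \<open>a \<noteq> b\<close> by (intro conjI exI[of _ "1/2::real"]) auto
  then show False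
    using assms by (auto simp: vertices_def extreme_point_of_def)
qed

section \<open>Active constraints and vertices\<close>

lemma polyhedron_inequalities:
  fixes P :: "'a::euclidean_space set"
  assumes "polyhedron P"
  obtains F :: "'a set set" and a b where
    "finite F" "P = {x. \<forall>h\<in>F. a h \<bullet> x \<le> b h}"
proof -
  obtain F where F: "finite F" "P = \<Inter>F" "\<forall>h\<in>F. \<exists>a b. a \<noteq> 0 \<and> h = {x. a \<bullet> x \<le> b}"
    using assms unfolding polyhedron_def by blast
  then obtain a b where "\<And>h. h \<in> F \<Longrightarrow> h = {x. a h \<bullet> x \<le> b h}"
    by metis
  then have "\<Inter>F = {x. \<forall>h\<in>F. a h \<bullet> x \<le> b h}" by blast
  with F(2) have "P = {x. \<forall>h\<in>F. a h \<bullet> x \<le> b h}" by (rule trans)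
  then show ?thesis by (rule that[OF F(1)])
qed

text \<open>Inactive constraints have slack and active ones do not grow along \<open>d\<close>; as
  there are finitely many, all sufficiently small steps are feasible.\<close>

lemma inequalities_feasible_direction:
  fixes d :: "'a::real_inner"
  assumes "finite F" "\<forall>h\<in>F. a h \<bullet> x \<le> b h" "\<forall>h\<in>F. a h \<bullet> x = b h \<longrightarrow> a h \<bullet> d \<le> 0"
  shows "eventually (\<lambda>e. \<forall>h\<in>F. a h \<bullet> (x + e *\<^sub>R d) \<le> b h) (at_right 0)"
proof (rule eventually_ball_finite[OF assms(1)], intro ballI)
  fix h assume h: "h \<in> F"
  show "eventually (\<lambda>e. a h \<bullet> (x + e *\<^sub>R d) \<le> b h) (at_right 0)"
  proof (cases "a h \<bullet> x = b h")
    case True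
    then have "a h \<bullet> d \<le> 0" using assms h by blast
    with True have "a h \<bullet> (x + e *\<^sub>R d) \<le> b h" if "e > 0" for e
      using that by (simp add: inner_add_right mult_nonneg_nonpos)
    then show ?thesis
      using eventually_at_right_less[of "0::real"] by (auto elim: eventually_mono)
  next
    case False
    then have "a h \<bullet> (x + 0 *\<^sub>R d) < b h" using assms h by force
    moreover have "((\<lambda>e. a h \<bullet> (x + e *\<^sub>R d)) \<longlongrightarrow> a h \<bullet> (x + 0 *\<^sub>R d)) (at_right 0)"
      by (intro tendsto_intros)
    ultimately have "eventually (\<lambda>e. a h \<bullet> (x + e *\<^sub>R d) < b h) (at_right 0)"
      using order_tendstoD(2) by blast
    then show ?thesis by (auto elim: eventually_mono)
  qed
qed

text \<open>Orthogonality to the active normals makes both \<open>d\<close> and \<open>- d\<close>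
  feasible, so the vertex is the midpoint of two points of \<open>P\<close>, which must
  coincide.\<close>

lemma vertex_active_span:
  fixes d :: "real ^ 'n"
  assumes F: "finite F" "P = {x. \<forall>h\<in>F. a h \<bullet> x \<le> b h}" and w: "w \<in> vertices P"
    and d: "\<And>h. h \<in> F \<Longrightarrow> a h \<bullet> w = b h \<Longrightarrow> a h \<bullet> d = 0"
  shows "d = 0"
proof -
  have wP: "\<forall>h\<in>F. a h \<bullet> w \<le> b h" using w F by (auto simp: vertices_def extreme_point_of_def)
  have "eventually (\<lambda>e. \<forall>h\<in>F. a h \<bullet> (w + e *\<^sub>R d) \<le> b h) (at_right 0)"
    "eventually (\<lambda>e. \<forall>h\<in>F. a h \<bullet> (w + e *\<^sub>R (- d)) \<le> b h) (at_right 0)"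
    by (rule inequalities_feasible_direction; use F wP d in auto)+
  then have "eventually (\<lambda>e. w + e *\<^sub>R d \<in> P \<and> w + e *\<^sub>R (- d) \<in> P \<and> 0 < e) (at_right 0)"
    using eventually_at_right_less[of "0::real"] by eventually_elim (auto simp: F)
  then obtain e where e: "w + e *\<^sub>R d \<in> P" "w + e *\<^sub>R (- d) \<in> P" "0 < e"
    using eventually_happens' trivial_limit_at_right_real by blast
  have "w + e *\<^sub>R d = w + e *\<^sub>R (- d)"
    by (rule vertex_midpoint[OF w e(1,2)]) (simp add: scaleR_2)
  then have "(2 * e) *\<^sub>R d = 0"
    by (simp add: scaleR_2 flip: scaleR_scaleR)
  with e show ?thesis by simp
qed

text \<open>A convex set without interior lies in a hyperplane, here through the origin. The normal
  cone contains the negated active normals, so the hyperplane's normal would be orthogonal to all of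
  them.\<close>

lemma active_span_interior:
  fixes w :: "real ^ 'n"
  assumes F: "P = {x. \<forall>h\<in>F. a h \<bullet> x \<le> b h}"
    and d: "\<And>d. (\<And>h. h \<in> F \<Longrightarrow> a h \<bullet> w = b h \<Longrightarrow> a h \<bullet> d = 0) \<Longrightarrow> d = 0"
  shows "interior (normal_cone P w) \<noteq> {}"
proof
  assume "interior (normal_cone P w) = {}"
  then obtain c k where c: "c \<noteq> 0" "normal_cone P w \<subseteq> {x. c \<bullet> x = k}"
    using empty_interior_subset_hyperplane[OF convex_normal_cone] by metis
  then have "k = 0" using zero_in_normal_cone[of P w] by auto
  have "a h \<bullet> c = 0" if "h \<in> F" "a h \<bullet> w = b h" for h
  proof -
    have "- a h \<in> normal_cone P w" using that F by (auto simp: normal_cone_def)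
    then show ?thesis using c \<open>k = 0\<close> by (auto simp: inner_commute)
  qed
  with d c(1) show False by blast
qed

lemma interior_normal_cone_vertex:
  assumes "polyhedron P" "w \<in> vertices P"
  shows "interior (normal_cone P w) \<noteq> {}"
proof -
  obtain F :: "(real ^ 'a) set set" and a b where F: "finite F" "P = {x. \<forall>h\<in>F. a h \<bullet> x \<le> b h}"
    using polyhedron_inequalities[OF assms(1)] by blast
  show ?thesis
    by (rule active_span_interior[OF F(2)]) (use vertex_active_span[OF F assms(2)] in blast)
qed

text \<open>While the active constraints do not span, one can move along a direction that does not increase
  the functional until a further constraint becomes active.\<close>

lemma inequalities_lp_vertex:
  fixes l :: "real ^ 'n"
  assumes F: "finite F" "P = {x. \<forall>h\<in>F. a h \<bullet> x \<le> b h}"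
    and noline: "\<And>d. (\<And>h. h \<in> F \<Longrightarrow> a h \<bullet> d = 0) \<Longrightarrow> d = 0"
    and bdd: "bdd_below ((\<bullet>) l ` P)" and x: "x \<in> P"
  shows "\<exists>y\<in>vertices P. l \<bullet> y \<le> l \<bullet> x"
  using x
\<comment> \<open>The measure is the number of constraints inactive at \<open>x\<close>.\<close>
proof (induction "card F - card {h\<in>F. a h \<bullet> x = b h}" arbitrary: x rule: less_induct)
  case less
  let ?act = "\<lambda>x. {h\<in>F. a h \<bullet> x = b h}"
  show ?case
  proof (cases "\<forall>d. (\<forall>h\<in>?act x. a h \<bullet> d = 0) \<longrightarrow> d = 0")
    case True
    have "interior (normal_cone P x) \<noteq> {}"
    proof (rule active_span_interior[OF F(2)])
      fix d assume "\<And>h. h \<in> F \<Longrightarrow> a h \<bullet> x = b h \<Longrightarrow> a h \<bullet> d = 0"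
      then have "\<forall>h\<in>?act x. a h \<bullet> d = 0" by blast
      from mp[OF spec[OF True, of d] this] show "d = 0" .
    qed
    then show ?thesis
      using vertex_if_interior_normal_cone less.prems by blast
  next
    case False
    then obtain d0 where d0: "d0 \<noteq> 0" "\<forall>h\<in>?act x. a h \<bullet> d0 = 0"
      unfolding not_all not_imp by (elim exE conjE)
    \<comment> \<open>Otherwise the whole ray from \<open>x\<close> along \<open>d\<close> would lie
      in \<open>P\<close>, with \<open>l\<close> unbounded below on it.\<close>
    have bounded: "\<exists>h\<in>F. a h \<bullet> d > 0" if ld: "l \<bullet> d < 0" for d
    proof (rule ccontr)
      assume "\<not> ?thesis"
      then have "t * (a h \<bullet> d) \<le> 0" if "h \<in> F" "t \<ge> 0" for h t
        using that by (meson mult_nonneg_nonpos not_less)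
      then have inP: "x + t *\<^sub>R d \<in> P" if "t \<ge> 0" for t
        using that less.prems unfolding F by (force simp: inner_add_right)
      obtain c where c: "\<And>y. y \<in> P \<Longrightarrow> c \<le> l \<bullet> y" using bdd by (auto simp: bdd_below_def)
      \<comment> \<open>At this \<open>t\<close> the functional takes the value
        \<open>c - 1\<close>, below the lower bound \<open>c\<close>.\<close>
      define t where "t = (c - l \<bullet> x - 1) / (l \<bullet> d)"
      have "t \<ge> 0" unfolding t_def using c[OF less.prems] ld by (intro divide_nonpos_neg) auto
      from c[OF inP[OF this]] show False using ld by (simp add: t_def inner_add_right)
    qed
    \<comment> \<open>If \<open>l\<close> is constant along \<open>d0\<close>, the sign is chosen so
      that some constraint is approached; otherwise the descending sign is taken, which meets a
      constraint by boundedness.\<close>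
    have "\<exists>d\<in>{d0, - d0}. l \<bullet> d \<le> 0 \<and> (\<exists>h\<in>F. a h \<bullet> d > 0)"
    proof (cases "l \<bullet> d0 = 0")
      case True
      obtain h where h: "h \<in> F" "a h \<bullet> d0 \<noteq> 0" using noline d0(1) by blast
      then have "a h \<bullet> d0 > 0 \<or> a h \<bullet> - d0 > 0" by auto
      with True h(1) show ?thesis by auto
    next
      case False
      then have "l \<bullet> d0 < 0 \<or> l \<bullet> - d0 < 0" by auto
      then show ?thesis
        using bounded by (meson insertCI less_imp_le)
    qed
    then obtain d where d: "d \<in> {d0, - d0}" "l \<bullet> d \<le> 0" "\<exists>h\<in>F. a h \<bullet> d > 0"
      by blast
    have act: "a h \<bullet> d = 0" if "h \<in> ?act x" for h
      using d(1) bspec[OF d0(2) that] by auto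
    define G where "G = {h\<in>F. a h \<bullet> d > 0}"
    \<comment> \<open>The ratio test of the simplex method: the longest step along \<open>d\<close>
      that stays in \<open>P\<close>. A constraint attaining the minimum becomes active.\<close>
    define t where "t = Min ((\<lambda>h. (b h - a h \<bullet> x) / (a h \<bullet> d)) ` G)"
    have G: "finite G" "G \<noteq> {}" using d(3) F by (auto simp: G_def)
    have tle: "t \<le> (b h - a h \<bullet> x) / (a h \<bullet> d)" if "h \<in> G" for h
      unfolding t_def using G that by (intro Min_le) auto
    have "t \<in> (\<lambda>h. (b h - a h \<bullet> x) / (a h \<bullet> d)) ` G"
      unfolding t_def using G by (intro Min_in) auto
    then obtain h0 where h0: "h0 \<in> G" "t = (b h0 - a h0 \<bullet> x) / (a h0 \<bullet> d)"
      by blast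
    have "t \<ge> 0"
      using h0 less.prems F by (auto simp: G_def intro!: divide_nonneg_pos)
    define y where "y = x + t *\<^sub>R d"
    have "a h \<bullet> y \<le> b h" if h: "h \<in> F" for h
    proof (cases "h \<in> G")
      case True
      then show ?thesis
        using tle[OF True] by (simp add: y_def inner_add_right G_def field_simps)
    next
      case False
      then have "t * (a h \<bullet> d) \<le> 0" using h \<open>t \<ge> 0\<close> by (simp add: G_def mult_nonneg_nonpos)
      then show ?thesis using less.prems h F by (force simp: y_def inner_add_right)
    qed
    then have yP: "y \<in> P" using F by blast
    have ly: "l \<bullet> y \<le> l \<bullet> x"
      using d(2) \<open>t \<ge> 0\<close> by (simp add: y_def inner_add_right mult_nonneg_nonpos)
    have "?act x \<subseteq> ?act y" using act by (auto simp: y_def inner_add_right)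
    moreover have "h0 \<in> ?act y" "h0 \<notin> ?act x"
      using h0 act[of h0] by (auto simp: y_def inner_add_right G_def field_simps)
    ultimately have "?act x \<subset> ?act y" by blast
    then have "card (?act x) < card (?act y)"
      using F by (intro psubset_card_mono) auto
    moreover have "card (?act y) \<le> card F" using F by (intro card_mono) auto
    ultimately have "\<exists>z\<in>vertices P. l \<bullet> z \<le> l \<bullet> y"
      using less.hyps[OF _ yP] by linarith
    with ly show ?thesis by (meson order_trans)
  qed
qed

section \<open>Supports as cones of functionals bounded below\<close>

lemma finite_vertices: "polyhedron P \<Longrightarrow> finite (vertices P)"
  unfolding vertices_def by (rule finite_polyhedron_extreme_points)

lemma vertices_subset: "vertices P \<subseteq> P"
  by (auto simp: vertices_def extreme_point_of_def)

lemma normal_cone_bdd_below: "l \<in> normal_cone P w \<Longrightarrow> bdd_below ((\<bullet>) l ` P)"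
  by (rule bdd_belowI2[of _ "l \<bullet> w"]) (simp add: normal_cone_def)

lemma normal_support_bdd_below: "l \<in> normal_support P \<Longrightarrow> bdd_below ((\<bullet>) l ` P)"
  by (auto simp: normal_support_def intro: normal_cone_bdd_below)

text \<open>A vertex rules out lines, so for a functional bounded below every point of
  \<open>P\<close> is matched or beaten by a vertex. The best of the finitely many vertices is then
  a minimiser.\<close>

lemma normal_support_eq:
  assumes "polyhedron P" "vertices P \<noteq> {}"
  shows "normal_support P = {l. bdd_below ((\<bullet>) l ` P)}"
proof -
  obtain F :: "(real ^ 'a) set set" and a b where F: "finite F" "P = {x. \<forall>h\<in>F. a h \<bullet> x \<le> b h}"
    using polyhedron_inequalities[OF assms(1)] by blast
  obtain w where w: "w \<in> vertices P" using assms by blast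
  have lp: "\<exists>y\<in>vertices P. l \<bullet> y \<le> l \<bullet> x" if "bdd_below ((\<bullet>) l ` P)" "x \<in> P" for l x
    by (rule inequalities_lp_vertex[OF F _ that]) (use vertex_active_span[OF F w] in blast)
  have *: "l \<in> normal_support P" if l: "bdd_below ((\<bullet>) l ` P)" for l
  proof -
    have fin: "finite ((\<bullet>) l ` vertices P)" "(\<bullet>) l ` vertices P \<noteq> {}"
      using finite_vertices[OF assms(1)] assms(2) by auto
    obtain y where y: "y \<in> vertices P" "l \<bullet> y = Min ((\<bullet>) l ` vertices P)"
      using Min_in[OF fin] by auto
    have "l \<bullet> y \<le> l \<bullet> x" if x: "x \<in> P" for x
    proof -
      obtain z where "z \<in> vertices P" "l \<bullet> z \<le> l \<bullet> x" using lp[OF l x] by blast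
      then show ?thesis using Min_le[OF fin(1), of "l \<bullet> z"] y(2) by auto
    qed
    with y(1) show ?thesis by (auto simp: normal_support_def normal_cone_def)
  qed
  show ?thesis
    by (intro set_eqI iffI) (simp_all add: normal_support_bdd_below *)
qed

text \<open>The tool for passing to generic functionals: the finitely many closed normal cones of
  vertices cover \<open>U\<close>, so one of them contains an open piece.\<close>

lemma open_subset_normal_cone_vertex:
  assumes P: "polyhedron P" "vertices P \<noteq> {}" and U: "open U" "U \<noteq> {}"
    and bdd: "\<And>l. l \<in> U \<Longrightarrow> bdd_below ((\<bullet>) l ` P)"
  obtains \<gamma> V where "\<gamma> \<in> vertices P" "open V" "V \<noteq> {}" "V \<subseteq> U" "V \<subseteq> normal_cone P \<gamma>"
proof -
  have "U \<subseteq> normal_support P" using bdd by (auto simp: normal_support_eq[OF P])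
  then obtain \<gamma> where "\<gamma> \<in> vertices P" "interior (U \<inter> normal_cone P \<gamma>) \<noteq> {}"
    unfolding normal_support_def
    by (rule closed_finite_cover_open[OF finite_vertices[OF P(1)] closed_normal_cone U])
  then show ?thesis
    using interior_subset[of "U \<inter> normal_cone P \<gamma>"] by (intro that) auto
qed

text \<open>If the constraint normals had a common orthogonal direction, they would have a rational
  one. Then \<open>P\<close> contains a line in that direction through a minimiser of
  \<open>\<omega>\<close>, so \<open>\<omega>\<close> vanishes on it, against rational
  independence.\<close>

lemma rational_polyhedron_vertices_nonempty:
  assumes \<omega>: "rationally_independent \<omega>" and P: "rational_polyhedron P" "P \<noteq> {}"
    and pos: "omega_positive \<omega> P"
  shows "vertices P \<noteq> {}"
proof -
  obtain F where F: "finite F" "P = \<Inter>F"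
      "\<forall>h\<in>F. \<exists>a b. a \<noteq> 0 \<and> (\<forall>i. a $ i \<in> \<rat>) \<and> b \<in> \<rat> \<and> h = {x. a \<bullet> x \<le> b}"
    using P(1) unfolding rational_polyhedron_def by blast
  then obtain a b where ab: "\<And>h. h \<in> F \<Longrightarrow> (\<forall>i. a h $ i \<in> \<rat>) \<and> h = {x. a h \<bullet> x \<le> b h}"
    by metis
  then have "\<Inter>F = {x. \<forall>h\<in>F. a h \<bullet> x \<le> b h}" by blast
  with F(2) have PF: "P = {x. \<forall>h\<in>F. a h \<bullet> x \<le> b h}" by (rule trans)
  have noline: "d = 0" if d: "\<And>h. h \<in> F \<Longrightarrow> a h \<bullet> d = 0" for d
  proof (rule ccontr)
    assume "d \<noteq> 0"
    obtain q where q: "q \<noteq> (\<lambda>_. 0)" "\<And>c. c \<in> a ` F \<Longrightarrow> c \<bullet> (\<chi> i. of_rat (q i)) = 0"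
      by (rule rational_common_orthogonal[of "a ` F" d]) (use ab d \<open>d \<noteq> 0\<close> in auto)
    define r :: "real ^ 'a" where "r = (\<chi> i. of_rat (q i))"
    obtain x where x: "x \<in> P" "\<And>y. y \<in> P \<Longrightarrow> \<omega> \<bullet> x \<le> \<omega> \<bullet> y"
      using pos by (auto simp: omega_positive_def)
    have "x + r \<in> P" "x - r \<in> P"
      using x(1) q(2) by (auto simp: PF r_def inner_add_right inner_diff_right)
    then have "\<omega> \<bullet> r = 0"
      using x(2)[of "x + r"] x(2)[of "x - r"] by (auto simp: inner_add_right inner_diff_right)
    then have "(\<Sum>i\<in>UNIV. of_rat (q i) * \<omega> $ i) = 0"
      by (simp add: inner_vec_def r_def mult.commute)
    then show False using \<omega> q(1) by (auto simp: rationally_independent_def)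
  qed
  obtain x where "x \<in> P" using P(2) by blast
  \<comment> \<open>The zero functional is bounded below on any set, so it already yields a
    vertex.\<close>
  then have "\<exists>y\<in>vertices P. 0 \<bullet> y \<le> 0 \<bullet> x"
    by (intro inequalities_lp_vertex[OF F(1) PF noline]) auto
  then show ?thesis by blast
qed

lemma rational_polyhedron_imp_polyhedron:
  assumes "rational_polyhedron P"
  shows "polyhedron P"
proof -
  obtain F where F: "finite F" "P = \<Inter>F"
      "\<forall>h\<in>F. \<exists>a b. a \<noteq> 0 \<and> (\<forall>i. a $ i \<in> \<rat>) \<and> b \<in> \<rat> \<and> h = {x. a \<bullet> x \<le> b}"
    using assms unfolding rational_polyhedron_def by blast
  from F(3) have "\<forall>h\<in>F. \<exists>a b. a \<noteq> 0 \<and> h = {x. a \<bullet> x \<le> b}" by blast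
  with F(1,2) show ?thesis unfolding polyhedron_def by blast
qed

section \<open>Extreme points of closed convex sets and sums of polyhedra\<close>

text \<open>Let \<open>V\<close> consist of the points of \<open>W\<close> with full-dimensional normal cone and let \<open>C\<close> be the dual of the
  cone of functionals bounded below on \<open>K\<close>. Separation gives \<open>K \<subseteq> conv V + C\<close>, while \<open>C\<close> lies in the
  recession cone of \<open>K\<close>, so an extreme point has no \<open>C\<close>-component.\<close>

lemma interior_normal_cone_extreme_closed_convex:
  fixes K :: "(real ^ 'n) set"
  assumes K: "closed K" "convex K" and W: "finite W" "W \<subseteq> K"
    and att: "\<And>l. bdd_below ((\<bullet>) l ` K) \<Longrightarrow> \<exists>w\<in>W. l \<in> normal_cone K w"
    and int: "interior {l. bdd_below ((\<bullet>) l ` K)} \<noteq> {}"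
    and z: "z \<in> vertices K"
  shows "interior (normal_cone K z) \<noteq> {}"
proof -
  define D where "D = {l. bdd_below ((\<bullet>) l ` K)}"
  define V where "V = {w\<in>W. interior (normal_cone K w) \<noteq> {}}"
  define C where "C = {x. \<forall>l\<in>D. 0 \<le> l \<bullet> x}"
  have sub: "normal_cone K w \<subseteq> D" for w
    by (auto simp: D_def intro: normal_cone_bdd_below)
  have Deq: "D = (\<Union>w\<in>W. normal_cone K w)"
  proof
    show "D \<subseteq> (\<Union>w\<in>W. normal_cone K w)" by (auto simp: D_def dest: att)
  qed (intro UN_least sub)
  have "closed D"
    unfolding Deq using W by (intro closed_UN) (auto intro: closed_normal_cone)
  have scale: "c *\<^sub>R l \<in> D" if l: "l \<in> D" and "c \<ge> 0" for l c
  proof -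
    obtain m where "\<And>x. x \<in> K \<Longrightarrow> m \<le> l \<bullet> x"
      using l by (auto simp: D_def bdd_below_def)
    then show ?thesis
      using \<open>c \<ge> 0\<close> by (auto simp: D_def intro!: bdd_belowI2[of _ "c * m"] mult_left_mono)
  qed
  have add: "l + k \<in> D" if lk: "l \<in> D" "k \<in> D" for l k
  proof -
    obtain m1 m2 where "\<And>x. x \<in> K \<Longrightarrow> m1 \<le> l \<bullet> x" "\<And>x. x \<in> K \<Longrightarrow> m2 \<le> k \<bullet> x"
      using lk by (auto simp: D_def bdd_below_def)
    then show ?thesis
      by (auto simp: D_def inner_add_left intro!: bdd_belowI2[of _ "m1 + m2"] add_mono)
  qed
  have "convex D"
    unfolding convex_def using scale add by blast
  have "0 \<in> D" using zero_in_normal_cone sub by blast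
  have cov: "D \<subseteq> (\<Union>w\<in>V. normal_cone K w)"
    unfolding V_def
    by (rule convex_finite_cover_full[OF W(1)])
      (use \<open>convex D\<close> int Deq in \<open>auto simp: D_def intro: closed_normal_cone\<close>)
  have fV: "finite V" "V \<subseteq> K" using W by (auto simp: V_def)
  have "V \<noteq> {}" using cov \<open>0 \<in> D\<close> by blast
  have "closed C"
  proof -
    have "C = (\<Inter>l\<in>D. {x. 0 \<le> l \<bullet> x})" by (auto simp: C_def)
    then show ?thesis by (auto intro: closed_halfspace_ge)
  qed
  have "convex C"
  proof -
    have "C = (\<Inter>l\<in>D. {x. 0 \<le> l \<bullet> x})" by (auto simp: C_def)
    then show ?thesis by (auto intro: convex_halfspace_ge convex_INT)
  qed
  have C0: "0 \<in> C" by (simp add: C_def)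
  have Cscale: "t *\<^sub>R c \<in> C" if "c \<in> C" "t \<ge> 0" for c t
    using that by (simp add: C_def)
  define T where "T = (\<Union>x\<in>convex hull V. \<Union>y\<in>C. {x + y})"
  have "closed T"
    unfolding T_def
    by (intro compact_closed_sums finite_imp_compact_convex_hull fV \<open>closed C\<close>)
  have "convex T"
    unfolding T_def by (intro convex_sums convex_convex_hull \<open>convex C\<close>)
  \<comment> \<open>The bipolar theorem for the closed convex cone \<open>D\<close>: by scaling, a
    functional separating \<open>l\<close> from \<open>D\<close> is nonnegative on \<open>D\<close>,
    so it is an element of \<open>C\<close> on which \<open>l\<close> is negative.\<close>
  have bipolar: "l \<in> D" if l: "\<And>c. c \<in> C \<Longrightarrow> 0 \<le> l \<bullet> c" for l
  proof (rule ccontr)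
    assume "l \<notin> D"
    then obtain c b where cb: "c \<bullet> l < b" "\<And>y. y \<in> D \<Longrightarrow> b < c \<bullet> y"
      using separating_hyperplane_closed_point[OF \<open>convex D\<close> \<open>closed D\<close>] by blast
    have "b < 0" using cb(2)[OF \<open>0 \<in> D\<close>] by simp
    have "0 \<le> c \<bullet> y" if y: "y \<in> D" for y
    proof (rule ccontr)
      assume neg: "\<not> 0 \<le> c \<bullet> y"
      then have "(b / (c \<bullet> y)) *\<^sub>R y \<in> D"
        using y \<open>b < 0\<close> by (intro scale) (auto intro: divide_nonpos_neg)
      from cb(2)[OF this] show False using neg by simp
    qed
    then have "c \<in> C" by (auto simp: C_def inner_commute)
    from l[OF this] cb(1) \<open>b < 0\<close> show False by (simp add: inner_commute)
  qed
  have "K \<subseteq> T"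
  proof
    fix x assume x: "x \<in> K"
    show "x \<in> T"
    proof (rule ccontr)
      assume "x \<notin> T"
      then obtain l b where lb: "l \<bullet> x < b" "\<And>y. y \<in> T \<Longrightarrow> b < l \<bullet> y"
        using separating_hyperplane_closed_point[OF \<open>convex T\<close> \<open>closed T\<close>] by blast
      have VC: "b < l \<bullet> (v + c)" if "v \<in> V" "c \<in> C" for v c
        using that by (intro lb(2)) (auto simp: T_def intro: hull_inc)
      have "0 \<le> l \<bullet> c" if c: "c \<in> C" for c
      proof (rule ccontr)
        assume neg: "\<not> 0 \<le> l \<bullet> c"
        obtain v where v: "v \<in> V" using \<open>V \<noteq> {}\<close> by blast
        have "b < l \<bullet> v" using VC[OF v C0] by simp
        \<comment> \<open>The multiple of \<open>c\<close> for which \<open>l\<close> takes exactly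
          the value \<open>b\<close> at the sum with \<open>v\<close>, contradicting strict
          separation.\<close>
        then have "((b - l \<bullet> v) / (l \<bullet> c)) *\<^sub>R c \<in> C"
          using neg by (intro Cscale[OF c] divide_nonpos_neg) auto
        from VC[OF v this] show False using neg by (simp add: inner_add_right)
      qed
      \<comment> \<open>The separating functional thus attains its minimum over \<open>K\<close> at
        a point of \<open>V\<close>, which also lies in \<open>T\<close>.\<close>
      then have "l \<in> D" by (rule bipolar)
      then obtain v where v: "v \<in> V" "l \<in> normal_cone K v" using cov by blast
      then have "l \<bullet> v \<le> l \<bullet> x" using x by (auto simp: normal_cone_def)
      then show False using VC[OF v(1) C0] lb(1) by simp
    qed
  qed
  have zK: "z \<in> K" using z vertices_subset by blast
  with \<open>K \<subseteq> T\<close> have "z \<in> T" by blast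
  then obtain a c where ac: "a \<in> convex hull V" "c \<in> C" "z = a + c"
    by (auto simp: T_def)
  have aK: "a \<in> K" using ac(1) hull_minimal[of V K convex] fV K by blast
  \<comment> \<open>\<open>K\<close> is an intersection of half-spaces whose functionals lie in
    \<open>D\<close>, and these do not decrease along \<open>c\<close>. So \<open>z = a + c\<close>
    is the midpoint of two points of \<open>K\<close>, which forces \<open>c = 0\<close>.\<close>
  have "a + 2 *\<^sub>R c \<in> K"
  proof (rule ccontr)
    assume "a + 2 *\<^sub>R c \<notin> K"
    then obtain l b where lb: "l \<bullet> (a + 2 *\<^sub>R c) < b" "\<And>y. y \<in> K \<Longrightarrow> b < l \<bullet> y"
      using separating_hyperplane_closed_point[OF K(2,1)] by blast
    then have "l \<in> D" by (auto simp: D_def intro!: bdd_belowI2[of _ b] less_imp_le)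
    then have "0 \<le> l \<bullet> c" using ac(2) by (auto simp: C_def)
    with lb(1) lb(2)[OF aK] show False by (simp add: inner_add_right)
  qed
  then have "a = a + 2 *\<^sub>R c"
    by (intro vertex_midpoint[OF z aK]) (auto simp: ac(3) scaleR_2)
  then have "z \<in> convex hull V" using ac by simp
  moreover have "convex hull V \<subseteq> K" using hull_minimal[of V K convex] fV K by blast
  ultimately have "z extreme_point_of (convex hull V)"
    using z by (auto simp: vertices_def extreme_point_of_def)
  then have "z \<in> V" by (rule extreme_point_of_convex_hull)
  then show ?thesis by (simp add: V_def)
qed

text \<open>Polyhedra are the closed convex sets with finitely many exposed faces, and an exposed
  face of a Minkowski sum is a sum of exposed faces. Compactness of \<open>P\<close> keeps the sum
  closed.\<close>

lemma polyhedron_polytope_sum: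
  fixes P Q :: "'a::euclidean_space set"
  assumes "polytope P" "polyhedron Q"
  shows "polyhedron {x + y | x y. x \<in> P \<and> y \<in> Q}"
proof -
  let ?S = "{x + y | x y. x \<in> P \<and> y \<in> Q}"
  have eq: "?S = (\<Union>x\<in>P. \<Union>y\<in>Q. {x + y})" by auto
  have cvx: "convex P" "convex Q"
    using assms by (auto intro: polytope_imp_convex polyhedron_imp_convex)
  have "closed ?S"
    unfolding eq using assms
    by (intro compact_closed_sums polytope_imp_compact polyhedron_imp_closed)
  moreover have "convex ?S"
    unfolding eq by (intro convex_sums cvx)
  moreover have "finite {F. F exposed_face_of ?S}"
  proof (rule finite_subset)
    show "{F. F exposed_face_of ?S} \<subseteq>
        (\<lambda>(k, l). {x + y | x y. x \<in> k \<and> y \<in> l}) `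
          ({k. k exposed_face_of P} \<times> {l. l exposed_face_of Q})"
    proof
      fix F assume "F \<in> {F. F exposed_face_of ?S}"
      then obtain k l where "k exposed_face_of P" "l exposed_face_of Q"
          "F = {x + y | x y. x \<in> k \<and> y \<in> l}"
        using exposed_face_of_sums[OF cvx] by blast
      then show "F \<in> (\<lambda>(k, l). {x + y | x y. x \<in> k \<and> y \<in> l}) `
          ({k. k exposed_face_of P} \<times> {l. l exposed_face_of Q})"
        by (intro image_eqI[of _ _ "(k, l)"]) auto
    qed
    show "finite ((\<lambda>(k, l). {x + y | x y. x \<in> k \<and> y \<in> l}) `
          ({k. k exposed_face_of P} \<times> {l. l exposed_face_of Q}))"
      using assms by (intro finite_imageI finite_cartesian_product finite_polyhedron_exposed_faces)
        (auto intro: polytope_imp_polyhedron)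
  qed
  ultimately show ?thesis
    using polyhedron_eq_finite_exposed_faces by blast
qed

section \<open>Values of polyhedral polynomials\<close>

lemma scaleR_mem_sum_copies:
  fixes P :: "'a::real_vector set"
  shows "p \<in> P \<Longrightarrow> real i *\<^sub>R p \<in> (\<Sum>k<i. P)"
proof (induction i)
  case (Suc i)
  then have "real i *\<^sub>R p + p \<in> (\<Sum>k<i. P) + P"
    by (intro set_plus_intro) auto
  moreover have "real (Suc i) *\<^sub>R p = real i *\<^sub>R p + p"
    by (simp add: scaleR_left_distrib)
  ultimately show ?case
    by (simp only: sum.lessThan_Suc)
qed (simp add: set_zero)

lemma inner_sum_copies_ge:
  fixes l :: "'a::real_inner"
  assumes "\<And>p. p \<in> P \<Longrightarrow> m \<le> l \<bullet> p" "x \<in> (\<Sum>k<i. P)"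
  shows "real i * m \<le> l \<bullet> x"
  using assms(2)
proof (induction i arbitrary: x)
  case 0
  then show ?case by (simp add: set_zero)
next
  case (Suc i)
  then obtain y p where "x = y + p" "y \<in> (\<Sum>k<i. P)" "p \<in> P"
    by (auto elim: set_plus_elim)
  then show ?case
    using Suc.IH[of y] assms(1)[of p] by (simp add: inner_add_right algebra_simps)
qed

lemma summand_mem: "q \<in> \<phi> i \<Longrightarrow> p \<in> P \<Longrightarrow> q + real i *\<^sub>R p \<in> summand \<phi> P i"
  unfolding summand_def by (intro set_plus_intro scaleR_mem_sum_copies)

text \<open>Minima of a functional add up under Minkowski sum.\<close>

lemma normal_cone_summand:
  "normal_cone (\<phi> i) q \<inter> normal_cone P p \<subseteq> normal_cone (summand \<phi> P i) (q + real i *\<^sub>R p)"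
proof
  fix l assume l: "l \<in> normal_cone (\<phi> i) q \<inter> normal_cone P p"
  show "l \<in> normal_cone (summand \<phi> P i) (q + real i *\<^sub>R p)"
    unfolding normal_cone_def
  proof (intro CollectI ballI)
    fix x assume "x \<in> summand \<phi> P i"
    then obtain y z where x: "x = y + z" "y \<in> \<phi> i" "z \<in> (\<Sum>k<i. P)"
      unfolding summand_def by (rule set_plus_elim)
    have "real i * (l \<bullet> p) \<le> l \<bullet> z"
      by (rule inner_sum_copies_ge[OF _ x(3)]) (use l in \<open>auto simp: normal_cone_def\<close>)
    moreover have "l \<bullet> q \<le> l \<bullet> y" using l x(2) by (auto simp: normal_cone_def)
    ultimately show "l \<bullet> (q + real i *\<^sub>R p) \<le> l \<bullet> x"
      by (simp add: x(1) inner_add_right)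
  qed
qed

lemma summand_subset_poly_value: "i \<in> Supp \<phi> \<Longrightarrow> summand \<phi> P i \<subseteq> poly_value \<phi> P"
  unfolding poly_value_def hull_Sum_def
  by (meson UN_upper closure_subset hull_subset order_trans)

lemma poly_value_closed_convex: "closed (poly_value \<phi> P)" "convex (poly_value \<phi> P)"
  by (simp_all add: poly_value_def hull_Sum_def convex_closure)

lemma poly_value_bound:
  assumes "\<And>i x. i \<in> Supp \<phi> \<Longrightarrow> x \<in> summand \<phi> P i \<Longrightarrow> m \<le> l \<bullet> x" "x \<in> poly_value \<phi> P"
  shows "m \<le> l \<bullet> x"
proof -
  have "poly_value \<phi> P \<subseteq> {x. l \<bullet> x \<ge> m}"
    unfolding poly_value_def hull_Sum_def
    by (intro closure_minimal hull_minimal closed_halfspace_ge convex_halfspace_ge)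
      (use assms(1) in auto)
  with assms(2) show ?thesis by auto
qed

lemma Supp_obtains_pos:
  assumes "2 \<le> card (Supp \<phi>)"
  obtains k where "k \<in> Supp \<phi>" "k > 0"
proof -
  have "\<not> Supp \<phi> \<subseteq> {0}"
    using assms card_mono[of "{0::nat}" "Supp \<phi>"] by auto
  then show ?thesis using that by blast
qed

text \<open>Fixing a point in one factor of a summand bounds the functional on the other. For
  \<open>P\<close> this takes a summand of positive exponent, which exists because the support has
  two elements.\<close>

lemma poly_value_bdd_below:
  assumes bdd: "bdd_below ((\<bullet>) l ` poly_value \<phi> P)" and card: "2 \<le> card (Supp \<phi>)"
    and "P \<noteq> {}"
  shows "bdd_below ((\<bullet>) l ` P)" "\<And>i. i \<in> Supp \<phi> \<Longrightarrow> bdd_below ((\<bullet>) l ` \<phi> i)"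
proof -
  obtain m where m: "\<And>x. x \<in> poly_value \<phi> P \<Longrightarrow> m \<le> l \<bullet> x"
    using bdd by (auto simp: bdd_below_def)
  have m': "m \<le> l \<bullet> q + real i * (l \<bullet> p)" if "i \<in> Supp \<phi>" "q \<in> \<phi> i" "p \<in> P" for i q p
    using m[of "q + real i *\<^sub>R p"] summand_subset_poly_value[of i \<phi> P] summand_mem[of q \<phi> i p P] that
    by (auto simp: inner_add_right)
  obtain p where "p \<in> P" using assms by blast
  show "bdd_below ((\<bullet>) l ` \<phi> i)" if "i \<in> Supp \<phi>" for i
    using m'[OF that _ \<open>p \<in> P\<close>] by (intro bdd_belowI2[of _ "m - real i * (l \<bullet> p)"]) force
  obtain k where k: "k \<in> Supp \<phi>" "k > 0" using Supp_obtains_pos[OF card] by blast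
  then obtain q where q: "q \<in> \<phi> k" by (auto simp: Supp_def)
  show "bdd_below ((\<bullet>) l ` P)"
  proof (rule bdd_belowI2)
    fix x assume "x \<in> P"
    from m'[OF k(1) q this] show "(m - l \<bullet> q) / real k \<le> l \<bullet> x"
      using k(2) by (simp add: field_simps)
  qed
qed

text \<open>What the comparison of solutions takes from \<open>\<omega>\<close> and the semiring:
  coefficients and their Minkowski sum are polyhedra with vertices.\<close>

definition pointed_polynomial :: "(nat \<Rightarrow> (real ^ 'n) set) \<Rightarrow> bool" where
  "pointed_polynomial \<phi> \<longleftrightarrow>
     finite (Supp \<phi>) \<and> 2 \<le> card (Supp \<phi>) \<and>
     (\<forall>i\<in>Supp \<phi>. polyhedron (\<phi> i) \<and> vertices (\<phi> i) \<noteq> {}) \<and>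
     polyhedron (coeff_sum \<phi>) \<and> vertices (coeff_sum \<phi>) \<noteq> {}"

lemma polyhedral_polynomial_pointed:
  assumes \<omega>: "rationally_independent \<omega>" and A: "polyhedral_semiring \<omega> A"
    and \<phi>: "polyhedral_polynomial A \<phi>"
  shows "pointed_polynomial \<phi>"
proof -
  have A_pointed: "polyhedron P \<and> vertices P \<noteq> {}" if "P \<in> A" "P \<noteq> {}" for P
  proof -
    have "rational_polyhedron P" "omega_positive \<omega> P"
      using that A by (auto simp: polyhedral_semiring_def positive_polyhedra_def)
    then show ?thesis
      using rational_polyhedron_vertices_nonempty[OF \<omega> _ that(2)] rational_polyhedron_imp_polyhedron
      by blast
  qed
  have A_sum: "P + Q \<in> A" if "P \<in> A" "Q \<in> A" for P Q
    using that A by (simp add: polyhedral_semiring_def)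
  have fin: "finite (Supp \<phi>)" and card: "2 \<le> card (Supp \<phi>)" and in_A: "\<And>i. \<phi> i \<in> A"
    using \<phi> by (auto simp: polyhedral_polynomial_def)
  \<comment> \<open>The induction starts at singletons because the empty sum is the singleton of the
    origin, which may fail to lie in \<open>A\<close>.\<close>
  have sum: "(\<Sum>i\<in>I. \<phi> i) \<in> A \<and> (\<Sum>i\<in>I. \<phi> i) \<noteq> {}"
    if "finite I" "I \<noteq> {}" "I \<subseteq> Supp \<phi>" for I
    using that
  proof (induction rule: finite_ne_induct)
    case (singleton i)
    then show ?case using in_A by (simp add: Supp_def)
  next
    case (insert i I)
    then have "\<phi> i \<noteq> {}" "(\<Sum>i\<in>I. \<phi> i) \<noteq> {}" "(\<Sum>i\<in>I. \<phi> i) \<in> A"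
      by (auto simp: Supp_def)
    then have "\<phi> i + (\<Sum>i\<in>I. \<phi> i) \<noteq> {}"
      by (auto simp: set_plus_def)
    moreover have "\<phi> i + (\<Sum>i\<in>I. \<phi> i) \<in> A"
      by (intro A_sum in_A) fact
    ultimately show ?case using insert.hyps by simp
  qed
  have "coeff_sum \<phi> \<in> A \<and> coeff_sum \<phi> \<noteq> {}"
    unfolding coeff_sum_def by (rule sum) (use fin card in auto)
  then show ?thesis
    using fin card in_A A_pointed by (auto simp: pointed_polynomial_def Supp_def)
qed

section \<open>Functionals bounded below on Minkowski sums\<close>

lemma bdd_below_inner_set_plus:
  fixes l :: "'a::real_inner"
  assumes "A \<noteq> {}" "B \<noteq> {}"
  shows "bdd_below ((\<bullet>) l ` (A + B)) \<longleftrightarrow> bdd_below ((\<bullet>) l ` A) \<and> bdd_below ((\<bullet>) l ` B)"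
proof (intro iffI conjI)
  assume "bdd_below ((\<bullet>) l ` (A + B))"
  then obtain m where "\<And>x. x \<in> A + B \<Longrightarrow> m \<le> l \<bullet> x" by (auto simp: bdd_below_def)
  then have m: "m \<le> l \<bullet> a + l \<bullet> b" if "a \<in> A" "b \<in> B" for a b
    using that by (metis inner_add_right set_plus_intro)
  obtain a b where ab: "a \<in> A" "b \<in> B" using assms by blast
  show "bdd_below ((\<bullet>) l ` A)"
    using m[OF _ ab(2)] by (intro bdd_belowI2[of _ "m - l \<bullet> b"]) (simp add: algebra_simps)
  show "bdd_below ((\<bullet>) l ` B)"
    using m[OF ab(1)] by (intro bdd_belowI2[of _ "m - l \<bullet> a"]) (simp add: algebra_simps)
next
  assume "bdd_below ((\<bullet>) l ` A) \<and> bdd_below ((\<bullet>) l ` B)"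
  then obtain m k where "\<And>a. a \<in> A \<Longrightarrow> m \<le> l \<bullet> a" "\<And>b. b \<in> B \<Longrightarrow> k \<le> l \<bullet> b"
    by (auto simp: bdd_below_def)
  then show "bdd_below ((\<bullet>) l ` (A + B))"
    by (intro bdd_belowI2[of _ "m + k"])
      (auto elim!: set_plus_elim simp: inner_add_right intro!: add_mono)
qed

lemma bdd_below_inner_set_sum:
  fixes l :: "'a::real_inner"
  assumes "finite I" "\<And>i. i \<in> I \<Longrightarrow> F i \<noteq> {}"
  shows "(\<Sum>i\<in>I. F i) \<noteq> {} \<and>
    (bdd_below ((\<bullet>) l ` (\<Sum>i\<in>I. F i)) \<longleftrightarrow> (\<forall>i\<in>I. bdd_below ((\<bullet>) l ` F i)))"
  using assms
proof (induction rule: finite_induct)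
  case empty
  then show ?case by (simp add: set_zero)
next
  case (insert i I)
  then have "F i \<noteq> {}" "(\<Sum>i\<in>I. F i) \<noteq> {}" by auto
  moreover from this have "F i + (\<Sum>i\<in>I. F i) \<noteq> {}" by (auto simp: set_plus_def)
  ultimately show ?case
    using insert by (simp add: bdd_below_inner_set_plus)
qed

lemma normal_support_coeff_sum:
  assumes "pointed_polynomial \<phi>"
  shows "normal_support (coeff_sum \<phi>) = {l. \<forall>i\<in>Supp \<phi>. bdd_below ((\<bullet>) l ` \<phi> i)}"
proof -
  have "normal_support (coeff_sum \<phi>) = {l. bdd_below ((\<bullet>) l ` coeff_sum \<phi>)}"
    using assms by (intro normal_support_eq) (auto simp: pointed_polynomial_def)
  moreover have "bdd_below ((\<bullet>) l ` coeff_sum \<phi>) \<longleftrightarrow> (\<forall>i\<in>Supp \<phi>. bdd_below ((\<bullet>) l ` \<phi> i))" for l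
  proof -
    have "finite (Supp \<phi>)" using assms by (simp add: pointed_polynomial_def)
    moreover have "\<phi> i \<noteq> {}" if "i \<in> Supp \<phi>" for i using that by (simp add: Supp_def)
    ultimately show ?thesis
      unfolding coeff_sum_def by (rule conjunct2[OF bdd_below_inner_set_sum])
  qed
  ultimately show ?thesis by simp
qed

text \<open>On the closed convex hull of a union the minimum is the least of the minima of the
  members, and on the summand of exponent \<open>i\<close> it is attained at
  \<open>q i + real i *\<^sub>R p\<close>.\<close>

lemma poly_value_min:
  assumes fin: "finite (Supp \<phi>)" "Supp \<phi> \<noteq> {}"
    and l: "\<And>i. i \<in> Supp \<phi> \<Longrightarrow> l \<in> normal_cone (\<phi> i) (q i)" "l \<in> normal_cone P p"
  shows "\<exists>i\<in>Supp \<phi>. l \<in> normal_cone (poly_value \<phi> P) (q i + real i *\<^sub>R p)"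
proof -
  let ?f = "\<lambda>i. l \<bullet> (q i + real i *\<^sub>R p)"
  have "Min (?f ` Supp \<phi>) \<in> ?f ` Supp \<phi>"
    using fin by (intro Min_in) auto
  then obtain i where i: "i \<in> Supp \<phi>" "Min (?f ` Supp \<phi>) = ?f i" by auto
  have min: "?f i \<le> ?f j" if "j \<in> Supp \<phi>" for j
    unfolding i(2)[symmetric] using fin that by (intro Min_le) auto
  have "?f i \<le> l \<bullet> x" if x: "x \<in> poly_value \<phi> P" for x
  proof (rule poly_value_bound[OF _ x])
    fix j y assume j: "j \<in> Supp \<phi>" "y \<in> summand \<phi> P j"
    have "l \<in> normal_cone (summand \<phi> P j) (q j + real j *\<^sub>R p)"
      using normal_cone_summand l j by blast
    then have "?f j \<le> l \<bullet> y" using j by (auto simp: normal_cone_def)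
    with min[OF j(1)] show "?f i \<le> l \<bullet> y" by simp
  qed
  with i(1) show ?thesis by (auto simp: normal_cone_def)
qed

text \<open>The criterion for closed convex sets applies to the value: a functional bounded below on
  it is bounded below on \<open>P\<close> and on all coefficients, hence attains its minimum in the
  finite set \<open>W\<close> of sums of vertices.\<close>

lemma interior_normal_cone_poly_value:
  assumes \<phi>: "pointed_polynomial \<phi>" and P: "polyhedron P" "vertices P \<noteq> {}"
    and int: "interior (normal_support P \<inter> normal_support (coeff_sum \<phi>)) \<noteq> {}"
    and w: "w \<in> vertices (poly_value \<phi> P)"
  shows "interior (normal_cone (poly_value \<phi> P) w) \<noteq> {}"
proof -
  have fin: "finite (Supp \<phi>)" and card: "2 \<le> card (Supp \<phi>)"
    and Q: "\<And>i. i \<in> Supp \<phi> \<Longrightarrow> polyhedron (\<phi> i)" "\<And>i. i \<in> Supp \<phi> \<Longrightarrow> vertices (\<phi> i) \<noteq> {}"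
    using \<phi> by (auto simp: pointed_polynomial_def)
  have ne: "Supp \<phi> \<noteq> {}" using card by auto
  have "P \<noteq> {}" using P(2) vertices_subset by blast
  define W where "W = (\<Union>i\<in>Supp \<phi>. (\<lambda>(q, p). q + real i *\<^sub>R p) ` (vertices (\<phi> i) \<times> vertices P))"
  have "finite W"
    unfolding W_def using fin Q P
    by (intro finite_UN_I finite_imageI finite_cartesian_product finite_vertices)
  have "W \<subseteq> poly_value \<phi> P"
  proof
    fix x assume "x \<in> W"
    then obtain i q p where x: "i \<in> Supp \<phi>" "q \<in> \<phi> i" "p \<in> P" "x = q + real i *\<^sub>R p"
      using vertices_subset by (fastforce simp: W_def)
    then show "x \<in> poly_value \<phi> P"
      using summand_subset_poly_value summand_mem by blast
  qed
  have min: "\<exists>w\<in>W. l \<in> normal_cone (poly_value \<phi> P) w"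
    if l: "bdd_below ((\<bullet>) l ` P)" "\<And>i. i \<in> Supp \<phi> \<Longrightarrow> bdd_below ((\<bullet>) l ` \<phi> i)" for l
  proof -
    have "l \<in> normal_support P" using l(1) by (simp add: normal_support_eq[OF P])
    then obtain p where p: "p \<in> vertices P" "l \<in> normal_cone P p"
      by (auto simp: normal_support_def)
    have "\<exists>q\<in>vertices (\<phi> i). l \<in> normal_cone (\<phi> i) q" if i: "i \<in> Supp \<phi>" for i
    proof -
      have "l \<in> normal_support (\<phi> i)" using l(2)[OF i] by (simp add: normal_support_eq[OF Q[OF i]])
      then show ?thesis by (auto simp: normal_support_def)
    qed
    then obtain q where q: "\<And>i. i \<in> Supp \<phi> \<Longrightarrow> q i \<in> vertices (\<phi> i)"
        "\<And>i. i \<in> Supp \<phi> \<Longrightarrow> l \<in> normal_cone (\<phi> i) (q i)"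
      by metis
    obtain i where "i \<in> Supp \<phi>" "l \<in> normal_cone (poly_value \<phi> P) (q i + real i *\<^sub>R p)"
      using poly_value_min[OF fin ne q(2) p(2)] by blast
    moreover from this have "q i + real i *\<^sub>R p \<in> W"
      using q(1) p(1) unfolding W_def
      by (intro UN_I[of i] image_eqI[of _ _ "(q i, p)"]) auto
    ultimately show ?thesis by blast
  qed
  have "normal_support P \<inter> normal_support (coeff_sum \<phi>) \<subseteq> {l. bdd_below ((\<bullet>) l ` poly_value \<phi> P)}"
  proof
    fix l assume l: "l \<in> normal_support P \<inter> normal_support (coeff_sum \<phi>)"
    have "\<exists>w\<in>W. l \<in> normal_cone (poly_value \<phi> P) w"
      by (rule min) (use l in \<open>auto simp: normal_support_coeff_sum[OF \<phi>] intro: normal_support_bdd_below\<close>)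
    then show "l \<in> {l. bdd_below ((\<bullet>) l ` poly_value \<phi> P)}"
      by (auto intro: normal_cone_bdd_below)
  qed
  then have int': "interior {l. bdd_below ((\<bullet>) l ` poly_value \<phi> P)} \<noteq> {}"
    using int interior_mono by blast
  show ?thesis
    by (rule interior_normal_cone_extreme_closed_convex[OF poly_value_closed_convex
          \<open>finite W\<close> \<open>W \<subseteq> _\<close> min int' w])
      (use poly_value_bdd_below[OF _ card \<open>P \<noteq> {}\<close>] in auto)
qed

text \<open>The open set is shrunk once per coefficient, each time into the normal cone of a single
  vertex.\<close>

lemma open_subset_coefficient_normal_cones:
  assumes Q: "\<And>i. i \<in> I \<Longrightarrow> polyhedron (\<phi> i)" "\<And>i. i \<in> I \<Longrightarrow> vertices (\<phi> i) \<noteq> {}"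
    and "finite I" "open U" "U \<noteq> {}"
    and bdd: "\<And>l i. l \<in> U \<Longrightarrow> i \<in> I \<Longrightarrow> bdd_below ((\<bullet>) l ` \<phi> i)"
  shows "\<exists>V q. open V \<and> V \<noteq> {} \<and> V \<subseteq> U \<and> (\<forall>i\<in>I. q i \<in> \<phi> i \<and> V \<subseteq> normal_cone (\<phi> i) (q i))"
  using \<open>finite I\<close> Q bdd
proof (induction rule: finite_induct)
  case empty
  then show ?case using assms by blast
next
  case (insert i I)
  have "\<exists>V q. open V \<and> V \<noteq> {} \<and> V \<subseteq> U \<and> (\<forall>i\<in>I. q i \<in> \<phi> i \<and> V \<subseteq> normal_cone (\<phi> i) (q i))"
    by (rule insert.IH) (use insert.prems in auto)
  then obtain V q where V: "open V" "V \<noteq> {}" "V \<subseteq> U"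
      "\<forall>i\<in>I. q i \<in> \<phi> i \<and> V \<subseteq> normal_cone (\<phi> i) (q i)"
    by blast
  obtain \<gamma> V' where V': "\<gamma> \<in> vertices (\<phi> i)" "open V'" "V' \<noteq> {}" "V' \<subseteq> V" "V' \<subseteq> normal_cone (\<phi> i) \<gamma>"
    by (rule open_subset_normal_cone_vertex[of "\<phi> i" V]) (use insert.prems V in auto)
  have "\<forall>j\<in>insert i I. (q(i := \<gamma>)) j \<in> \<phi> j \<and> V' \<subseteq> normal_cone (\<phi> j) ((q(i := \<gamma>)) j)"
    using V(4) V' insert.hyps(2) vertices_subset by fastforce
  then show ?case using V V' by (meson order_trans)
qed

text \<open>Whether a vertex selected by an open set of functionals occurs in two summands depends only on
  the vertex \<open>\<gamma>\<close> of the argument selected by these functionals. Shrinking the open set makes all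
  minimisers unique, so ties between summands are equalities of points.\<close>

lemma solution_vertex_transfer:
  assumes \<phi>: "pointed_polynomial \<phi>" and sol: "solution \<phi> P"
    and \<gamma>: "\<gamma> \<in> P" "\<gamma> \<in> P'" and U: "open U" "U \<noteq> {}"
    and UN: "U \<subseteq> normal_cone P \<gamma>" "U \<subseteq> normal_cone P' \<gamma>"
    and w: "w \<in> poly_value \<phi> P'" "U \<subseteq> normal_cone (poly_value \<phi> P') w"
  shows "\<exists>i\<in>Supp \<phi>. \<exists>j\<in>Supp \<phi>. i \<noteq> j \<and>
    w \<in> vertices (summand \<phi> P' i) \<and> w \<in> vertices (summand \<phi> P' j)"
proof -
  have fin: "finite (Supp \<phi>)" and card: "2 \<le> card (Supp \<phi>)"
    and Q: "\<And>i. i \<in> Supp \<phi> \<Longrightarrow> polyhedron (\<phi> i)" "\<And>i. i \<in> Supp \<phi> \<Longrightarrow> vertices (\<phi> i) \<noteq> {}"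
    using \<phi> by (auto simp: pointed_polynomial_def)
  have ne: "Supp \<phi> \<noteq> {}" using card by auto
  have "P' \<noteq> {}" using \<gamma> by blast
  have "\<exists>V q. open V \<and> V \<noteq> {} \<and> V \<subseteq> U \<and>
      (\<forall>i\<in>Supp \<phi>. q i \<in> \<phi> i \<and> V \<subseteq> normal_cone (\<phi> i) (q i))"
  proof (rule open_subset_coefficient_normal_cones[OF Q fin U])
    fix l i assume "l \<in> U" "i \<in> Supp \<phi>"
    then show "bdd_below ((\<bullet>) l ` \<phi> i)"
      using w(2) by (intro poly_value_bdd_below(2)[OF _ card \<open>P' \<noteq> {}\<close>] normal_cone_bdd_below) auto
  qed
  then obtain V q where V: "open V" "V \<noteq> {}" "V \<subseteq> U"
    and q: "\<And>i. i \<in> Supp \<phi> \<Longrightarrow> q i \<in> \<phi> i" "\<And>i. i \<in> Supp \<phi> \<Longrightarrow> V \<subseteq> normal_cone (\<phi> i) (q i)"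
    by blast
  \<comment> \<open>The point that \<open>V\<close> selects in the \<open>i\<close>-th summand. It
    is the same for \<open>P\<close> and \<open>P'\<close>, since both select \<gamma>.\<close>
  define x where "x i = q i + real i *\<^sub>R \<gamma>" for i
  have x_summand: "x i \<in> summand \<phi> P i" "x i \<in> summand \<phi> P' i" if "i \<in> Supp \<phi>" for i
    using that q(1) \<gamma> unfolding x_def by (auto intro: summand_mem)
  have x_value: "x i \<in> poly_value \<phi> P" "x i \<in> poly_value \<phi> P'" if "i \<in> Supp \<phi>" for i
    using x_summand[OF that] summand_subset_poly_value[OF that] by auto
  have V_summand: "V \<subseteq> normal_cone (summand \<phi> P i) (x i)" "V \<subseteq> normal_cone (summand \<phi> P' i) (x i)"
    if "i \<in> Supp \<phi>" for i
    using q(2)[OF that] UN V(3) normal_cone_summand[of \<phi> i "q i" P \<gamma>]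
      normal_cone_summand[of \<phi> i "q i" P' \<gamma>] unfolding x_def by blast+
  have min: "\<exists>i\<in>Supp \<phi>. l \<in> normal_cone (poly_value \<phi> R) (x i)"
    if "l \<in> V" "R = P \<or> R = P'" for l R
    unfolding x_def by (rule poly_value_min[OF fin ne]) (use that q(2) UN V(3) in blast)+
  obtain l where l: "l \<in> V" using V(2) by blast
  have lint: "l \<in> interior (normal_cone R y)" if "V \<subseteq> normal_cone R y" for R y
    using that l V(1) by (meson interior_maximal subsetD)
  obtain i0 where i0: "i0 \<in> Supp \<phi>" "l \<in> normal_cone (poly_value \<phi> P') (x i0)"
    using min[OF l] by blast
  have "V \<subseteq> normal_cone (poly_value \<phi> P') w" using V(3) w(2) by blast
  \<comment> \<open>Both points minimise \<open>l\<close> over the value at \<open>P'\<close>, and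
    the minimiser is unique.\<close>
  then have "x i0 = w"
    using i0 w(1) x_value(2)
    by (intro interior_normal_cone_unique[OF lint]) (auto simp: normal_cone_def)
  then have wP: "w \<in> poly_value \<phi> P" using x_value i0 by blast
  \<comment> \<open>The minimum over the value at \<open>P\<close> is attained at some
    \<open>x i\<close>. That point also lies in the value at \<open>P'\<close>, where
    \<open>w\<close> is at least as good.\<close>
  have VP: "V \<subseteq> normal_cone (poly_value \<phi> P) w"
  proof
    fix k assume k: "k \<in> V"
    obtain i where i: "i \<in> Supp \<phi>" "k \<in> normal_cone (poly_value \<phi> P) (x i)"
      using min[OF k] by blast
    have "k \<bullet> w \<le> k \<bullet> x i"
      using k V(3) w(2) x_value(2)[OF i(1)] by (auto simp: normal_cone_def)
    with i(2) show "k \<in> normal_cone (poly_value \<phi> P) w"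
      by (auto simp: normal_cone_def intro: order_trans)
  qed
  then have "w \<in> vertices (poly_value \<phi> P)"
    using lint wP by (intro vertex_if_interior_normal_cone) auto
  then obtain i j where ij: "i \<in> Supp \<phi>" "j \<in> Supp \<phi>" "i \<noteq> j"
      "w \<in> vertices (summand \<phi> P i)" "w \<in> vertices (summand \<phi> P j)"
    using sol unfolding solution_def by blast
  \<comment> \<open>The \<open>k\<close>-th summand at \<open>P\<close> has \<open>x k\<close> as
    unique minimiser, so \<open>w = x k\<close>; the same point is the unique minimiser in the
    summand at \<open>P'\<close>.\<close>
  have "w \<in> vertices (summand \<phi> P' k)" if k: "k \<in> Supp \<phi>" "w \<in> vertices (summand \<phi> P k)" for k
  proof -
    have "l \<bullet> w \<le> l \<bullet> x k"
      using VP l x_value(1)[OF k(1)] by (auto simp: normal_cone_def)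
    moreover have "w \<in> summand \<phi> P k" using k(2) vertices_subset by blast
    ultimately have "w = x k"
      by (intro interior_normal_cone_unique[OF lint[OF V_summand(1)[OF k(1)]]])
    then show ?thesis
      using x_summand(2)[OF k(1)] lint[OF V_summand(2)[OF k(1)]]
      by (intro vertex_if_interior_normal_cone) auto
  qed
  with ij show ?thesis by blast
qed

section \<open>Local and global solutions\<close>

text \<open>\<open>C\<close> is cut out by the constraints active at \<open>v\<close>, made
  homogeneous. Short steps from \<open>v\<close> along \<open>C\<close> stay in \<open>M\<close>,
  and \<open>x - v\<close> lies in \<open>C\<close> for every \<open>x\<close> in \<open>M\<close>,
  so the dual of \<open>C\<close> is the normal cone.\<close>

lemma polyhedron_tangent_cone:
  fixes M :: "(real ^ 'n) set"
  assumes "polyhedron M" "v \<in> M"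
  obtains C where "polyhedron C" "0 \<in> C" "\<And>c d. c \<in> C \<Longrightarrow> d \<in> C \<Longrightarrow> c + d \<in> C"
    "normal_cone M v = {l. \<forall>c\<in>C. 0 \<le> l \<bullet> c}"
proof -
  obtain F :: "(real ^ 'n) set set" and a b where F: "finite F" "M = {x. \<forall>h\<in>F. a h \<bullet> x \<le> b h}"
    using polyhedron_inequalities[OF assms(1)] by blast
  define C where "C = (\<Inter>h\<in>{h\<in>F. a h \<bullet> v = b h}. {x. a h \<bullet> x \<le> 0})"
  have vF: "\<forall>h\<in>F. a h \<bullet> v \<le> b h" using assms(2) F(2) by simp
  show ?thesis
  proof
    show "polyhedron C"
      unfolding C_def using F(1) by (intro polyhedron_Inter) (auto intro: polyhedron_halfspace_le)
    show "0 \<in> C" by (simp add: C_def)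
    show "c + d \<in> C" if "c \<in> C" "d \<in> C" for c d
      using that by (auto simp: C_def inner_add_right intro: add_nonpos_nonpos)
    show "normal_cone M v = {l. \<forall>c\<in>C. 0 \<le> l \<bullet> c}"
    proof (intro set_eqI iffI)
      fix l assume l: "l \<in> normal_cone M v"
      have "0 \<le> l \<bullet> c" if c: "c \<in> C" for c
      proof -
        have "eventually (\<lambda>e. \<forall>h\<in>F. a h \<bullet> (v + e *\<^sub>R c) \<le> b h) (at_right 0)"
          by (rule inequalities_feasible_direction[OF F(1) vF]) (use c in \<open>auto simp: C_def\<close>)
        then have "eventually (\<lambda>e. v + e *\<^sub>R c \<in> M \<and> 0 < e) (at_right 0)"
          using eventually_at_right_less[of "0::real"] by eventually_elim (simp add: F(2))
        then obtain e where e: "v + e *\<^sub>R c \<in> M" "0 < e"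
          using eventually_happens' trivial_limit_at_right_real by blast
        then have "l \<bullet> v \<le> l \<bullet> (v + e *\<^sub>R c)" using l by (simp add: normal_cone_def)
        then show ?thesis using e(2) by (simp add: inner_add_right zero_le_mult_iff)
      qed
      then show "l \<in> {l. \<forall>c\<in>C. 0 \<le> l \<bullet> c}" by simp
    next
      fix l assume l: "l \<in> {l. \<forall>c\<in>C. 0 \<le> l \<bullet> c}"
      have "l \<bullet> v \<le> l \<bullet> x" if x: "x \<in> M" for x
      proof -
        have "x - v \<in> C" using x unfolding C_def F(2) by (auto simp: inner_diff_right)
        then show ?thesis using l by (force simp: inner_diff_right)
      qed
      then show "l \<in> normal_cone M v" by (simp add: normal_cone_def)
    qed
  qed
qed

lemma convex_hull_inner_ge:
  fixes l :: "'a::euclidean_space"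
  assumes "\<And>x. x \<in> S \<Longrightarrow> m \<le> l \<bullet> x" "x \<in> convex hull S"
  shows "m \<le> l \<bullet> x"
proof -
  have "convex hull S \<subseteq> {x. l \<bullet> x \<ge> m}"
    by (intro hull_minimal convex_halfspace_ge) (use assms(1) in auto)
  with assms(2) show ?thesis by auto
qed

lemma finite_argmin:
  fixes f :: "'a \<Rightarrow> real"
  assumes "finite V" "V \<noteq> {}"
  obtains x where "x \<in> V" "\<And>y. y \<in> V \<Longrightarrow> f x \<le> f y"
proof -
  have "Min (f ` V) \<in> f ` V" using assms by (intro Min_in) auto
  then obtain x where "x \<in> V" "Min (f ` V) = f x" by auto
  then show ?thesis
    using Min_le[of "f ` V"] assms(1) by (intro that[of x]) (auto simp flip: \<open>Min (f ` V) = f x\<close>)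
qed

text \<open>The local solution at \<open>v\<close> is the convex hull of the vertices of the global one plus the
  tangent cone of \<open>M\<close> at \<open>v\<close>; this cone is dual to \<open>N\<^sub>M(v)\<close>, so exactly the
  functionals outside \<open>N\<^sub>M(v)\<close> become unbounded.\<close>

lemma complete_local_solution_from_global:
  assumes \<phi>: "pointed_polynomial \<phi>" and P: "global_solution \<phi> P"
    and v: "v \<in> vertices (coeff_sum \<phi>)"
  obtains S where "complete_local_solution \<phi> v S" "vertices P \<subseteq> S" "vertices S \<subseteq> vertices P"
proof -
  let ?M = "coeff_sum \<phi>"
  have M: "polyhedron ?M" "vertices ?M \<noteq> {}" and card: "2 \<le> card (Supp \<phi>)"
    using \<phi> by (auto simp: pointed_polynomial_def)
  have sol: "solution \<phi> P" and NMP: "normal_support ?M \<subseteq> normal_support P"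
    using P by (auto simp: global_solution_def)
  have Ppoly: "polyhedron P" "vertices P \<noteq> {}" using sol by (auto simp: solution_def)
  have finP: "finite (vertices P)" by (rule finite_vertices[OF Ppoly(1)])
  have NM: "normal_cone ?M v \<subseteq> normal_support ?M"
    using v by (auto simp: normal_support_def)
  have intv: "interior (normal_cone ?M v) \<noteq> {}"
    by (rule interior_normal_cone_vertex[OF M(1) v])
  obtain C where C: "polyhedron C" "0 \<in> C" "\<And>c d. c \<in> C \<Longrightarrow> d \<in> C \<Longrightarrow> c + d \<in> C"
      "normal_cone ?M v = {l. \<forall>c\<in>C. 0 \<le> l \<bullet> c}"
    by (rule polyhedron_tangent_cone[OF M(1), of v]) (use v vertices_subset in auto)
  define S where "S = {x + y | x y. x \<in> convex hull vertices P \<and> y \<in> C}"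
  have S: "polyhedron S"
    unfolding S_def by (intro polyhedron_polytope_sum polytope_convex_hull finP C(1))
  have SI: "x + c \<in> S" if "x \<in> convex hull vertices P" "c \<in> C" for x c
    using that by (auto simp: S_def)
  have subS: "convex hull vertices P \<subseteq> S" using SI[OF _ C(2)] by auto
  then have VPS: "vertices P \<subseteq> S"
    using hull_subset[of "vertices P" convex] by (rule order_trans[rotated])
  \<comment> \<open>A vertex \<open>x + c\<close> is the midpoint of \<open>x\<close> and
    \<open>x + (c + c)\<close>, so its cone component is zero.\<close>
  have VSP: "vertices S \<subseteq> vertices P"
  proof
    fix w assume w: "w \<in> vertices S"
    then have "w \<in> S" using vertices_subset by blast
    then obtain x c where xc: "x \<in> convex hull vertices P" "c \<in> C" "w = x + c"
      by (auto simp: S_def)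
    have "x = x + (c + c)"
    proof (rule vertex_midpoint[OF w])
      show "x \<in> S" using xc(1) subS by blast
      show "x + (c + c) \<in> S" using xc by (intro SI C(3))
      show "2 *\<^sub>R w = x + (x + (c + c))" by (simp only: xc(3) scaleR_2 ac_simps)
    qed
    then have "2 *\<^sub>R c = 0" by (simp only: scaleR_2 add_cancel_right_right)
    then have "w \<in> convex hull vertices P" using xc by simp
    then have "w extreme_point_of (convex hull vertices P)"
      using w subS by (auto simp: vertices_def extreme_point_of_def)
    then show "w \<in> vertices P" by (rule extreme_point_of_convex_hull)
  qed
  have minS: "\<exists>\<gamma>\<in>vertices P. l \<in> normal_cone S \<gamma>" if l: "l \<in> normal_cone ?M v" for l
  proof -
    obtain \<gamma> where \<gamma>: "\<gamma> \<in> vertices P" "\<And>y. y \<in> vertices P \<Longrightarrow> l \<bullet> \<gamma> \<le> l \<bullet> y"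
      using finite_argmin[OF finP Ppoly(2), of "(\<bullet>) l"] by blast
    have "l \<bullet> \<gamma> \<le> l \<bullet> (x + c)" if "x \<in> convex hull vertices P" "c \<in> C" for x c
    proof -
      have "l \<bullet> \<gamma> \<le> l \<bullet> x" by (rule convex_hull_inner_ge[OF \<gamma>(2) that(1)])
      moreover have "0 \<le> l \<bullet> c" using l that(2) by (simp add: C(4))
      ultimately show ?thesis by (simp add: inner_add_right)
    qed
    then have "l \<in> normal_cone S \<gamma>" by (auto simp: normal_cone_def S_def)
    with \<gamma>(1) show ?thesis by blast
  qed
  \<comment> \<open>The minimisers among the vertices of \<open>P\<close> cover an open set of
    functionals, so one of them has a full-dimensional normal cone and is a vertex of
    \<open>S\<close>.\<close>
  have "interior (normal_cone ?M v) \<subseteq> (\<Union>\<gamma>\<in>vertices P. normal_cone S \<gamma>)"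
    using minS interior_subset[of "normal_cone ?M v"] by blast
  then obtain \<gamma> where "\<gamma> \<in> vertices P" "interior (interior (normal_cone ?M v) \<inter> normal_cone S \<gamma>) \<noteq> {}"
    by (rule closed_finite_cover_open[OF finP closed_normal_cone open_interior intv])
  then have "\<gamma> \<in> vertices S"
    using VPS interior_mono[of "interior (normal_cone ?M v) \<inter> normal_cone S \<gamma>" "normal_cone S \<gamma>"]
    by (intro vertex_if_interior_normal_cone) auto
  then have VS: "vertices S \<noteq> {}" by blast
  have NS: "normal_support S = normal_cone ?M v"
  proof (intro set_eqI iffI)
    fix l assume "l \<in> normal_support S"
    then obtain w where w: "w \<in> vertices S" "l \<in> normal_cone S w"
      by (auto simp: normal_support_def)
    then have wS: "w \<in> convex hull vertices P" using VSP by (auto intro: hull_inc)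
    have "0 \<le> l \<bullet> c" if "c \<in> C" for c
    proof -
      have "l \<bullet> w \<le> l \<bullet> (w + c)" using w(2) SI[OF wS that] by (simp add: normal_cone_def)
      then show ?thesis by (simp add: inner_add_right)
    qed
    then show "l \<in> normal_cone ?M v" by (simp add: C(4))
  next
    fix l assume "l \<in> normal_cone ?M v"
    then show "l \<in> normal_support S"
      using minS[of l] by (auto simp: normal_support_eq[OF S VS] intro: normal_cone_bdd_below)
  qed
  have "\<exists>i\<in>Supp \<phi>. \<exists>j\<in>Supp \<phi>. i \<noteq> j \<and>
      w \<in> vertices (summand \<phi> S i) \<and> w \<in> vertices (summand \<phi> S j)"
    if w: "w \<in> vertices (poly_value \<phi> S)" for w
  proof -
    let ?U = "interior (normal_cone (poly_value \<phi> S) w)"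
    have "interior (normal_support S \<inter> normal_support ?M) \<noteq> {}"
      using intv NM by (simp add: NS Int_absorb2)
    then have ne: "?U \<noteq> {}"
      by (rule interior_normal_cone_poly_value[OF \<phi> S VS _ w])
    have "S \<noteq> {}" using VS vertices_subset by blast
    have bdd: "bdd_below ((\<bullet>) l ` S)" if "l \<in> ?U" for l
      by (rule poly_value_bdd_below(1)[OF _ card \<open>S \<noteq> {}\<close>])
        (rule normal_cone_bdd_below[OF subsetD[OF interior_subset that]])
    obtain \<gamma> U where U: "\<gamma> \<in> vertices S" "open U" "U \<noteq> {}" "U \<subseteq> ?U" "U \<subseteq> normal_cone S \<gamma>"
      by (rule open_subset_normal_cone_vertex[OF S VS open_interior ne bdd])
    \<comment> \<open>Globality enters here: functionals in N(M) attain their minimum over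
      \<open>P\<close> at a vertex of \<open>P\<close>. This vertex lies in \<open>S\<close>, where
      \<gamma> is at least as good.\<close>
    have "U \<subseteq> normal_cone P \<gamma>"
    proof
      fix l assume l: "l \<in> U"
      then have "l \<in> normal_support S" using U by (auto simp: normal_support_def)
      then have "l \<in> normal_support P" using NS NM NMP by blast
      then obtain \<gamma>' where \<gamma>': "\<gamma>' \<in> vertices P" "l \<in> normal_cone P \<gamma>'"
        by (auto simp: normal_support_def)
      then have "l \<bullet> \<gamma> \<le> l \<bullet> \<gamma>'" using l U(5) VPS by (auto simp: normal_cone_def)
      with \<gamma>'(2) show "l \<in> normal_cone P \<gamma>" by (auto simp: normal_cone_def intro: order_trans)
    qed
    then show ?thesis
      using U VSP vertices_subset[of S] vertices_subset[of P] vertices_subset[of "poly_value \<phi> S"] w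
        interior_subset[of "normal_cone (poly_value \<phi> S) w"]
      by (intro solution_vertex_transfer[OF \<phi> sol, of \<gamma> S U]) blast+
  qed
  then have "complete_local_solution \<phi> v S"
    using S VS NS by (simp add: complete_local_solution_def local_solution_def solution_def)
  with VPS VSP show ?thesis by (intro that)
qed

section \<open>Property (P) and gluing\<close>

lemma full_dimensional_iff_interior:
  fixes C :: "(real ^ 'n) set"
  assumes "convex C"
  shows "full_dimensional C \<longleftrightarrow> interior C \<noteq> {}"
proof
  assume full: "full_dimensional C"
  show "interior C \<noteq> {}"
  proof
    assume "interior C = {}"
    then obtain a b where ab: "a \<noteq> 0" "C \<subseteq> {x. a \<bullet> x = b}"
      using empty_interior_subset_hyperplane[OF assms] by metis
    then have "aff_dim C \<le> int DIM(real ^ 'n) - 1"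
      using aff_dim_subset[OF ab(2)] aff_dim_hyperplane[OF ab(1)] by simp
    with full show False by (simp add: full_dimensional_def)
  qed
next
  assume "interior C \<noteq> {}"
  then show "full_dimensional C"
    using aff_dim_nonempty_interior[of C] by (simp add: full_dimensional_def)
qed

text \<open>\<open>V\<close> stands for the vertex set of a global solution. A vertex \<gamma> of
  the glued polytope belongs to \<open>V\<close> and so to \<open>S v\<close>. For generic
  functionals in the intersection of cones, the vertex selected in \<open>S v\<close> lies in the
  glued polytope, where \<gamma> is the unique minimiser.\<close>

lemma compatible_from_global:
  assumes S: "\<And>v. v \<in> vertices (coeff_sum \<phi>) \<Longrightarrow> complete_local_solution \<phi> v (S v)"
      "\<And>v. v \<in> vertices (coeff_sum \<phi>) \<Longrightarrow> V \<subseteq> S v"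
      "\<And>v. v \<in> vertices (coeff_sum \<phi>) \<Longrightarrow> vertices (S v) \<subseteq> V"
  shows "compatible \<phi> S"
  unfolding compatible_def
proof (intro ballI impI)
  let ?M = "coeff_sum \<phi>" and ?G = "glued \<phi> S"
  fix v \<gamma> assume v: "v \<in> vertices ?M" and \<gamma>: "\<gamma> \<in> vertices ?G"
    and "full_dimensional (normal_cone ?M v \<inter> normal_cone ?G \<gamma>)"
  then have ne: "interior (normal_cone ?M v \<inter> normal_cone ?G \<gamma>) \<noteq> {}"
    using full_dimensional_iff_interior[OF convex_Int[OF convex_normal_cone convex_normal_cone]]
    by blast
  have Sv: "polyhedron (S v)" "vertices (S v) \<noteq> {}" "normal_support (S v) = normal_cone ?M v"
    using S(1)[OF v] by (auto simp: complete_local_solution_def local_solution_def solution_def)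
  have "\<gamma> extreme_point_of ?G" using \<gamma> by (simp add: vertices_def)
  then have "\<gamma> \<in> (\<Union>v\<in>vertices ?M. vertices (S v))"
    unfolding glued_def by (rule extreme_point_of_convex_hull)
  then have "\<gamma> \<in> V" using S(3) by blast
  then have \<gamma>S: "\<gamma> \<in> S v" using S(2) v by blast
  have bdd: "bdd_below ((\<bullet>) l ` S v)" if "l \<in> interior (normal_cone ?M v \<inter> normal_cone ?G \<gamma>)" for l
    using subsetD[OF interior_subset that] Sv(3) by (intro normal_support_bdd_below) simp
  obtain \<gamma>' U where U: "\<gamma>' \<in> vertices (S v)" "open U" "U \<noteq> {}"
      "U \<subseteq> interior (normal_cone ?M v \<inter> normal_cone ?G \<gamma>)" "U \<subseteq> normal_cone (S v) \<gamma>'"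
    by (rule open_subset_normal_cone_vertex[OF Sv(1,2) open_interior ne bdd])
  obtain l where l: "l \<in> U" using U(3) by blast
  have "\<gamma>' \<in> ?G" unfolding glued_def using U(1) v by (intro hull_inc) auto
  moreover have "l \<bullet> \<gamma>' \<le> l \<bullet> \<gamma>" using l U(5) \<gamma>S by (auto simp: normal_cone_def)
  moreover have "l \<in> interior (normal_cone ?G \<gamma>)"
    using l U(4) by auto
  ultimately have "\<gamma>' = \<gamma>" by (intro interior_normal_cone_unique)
  with U(1) show "\<gamma> \<in> vertices (S v)" by simp
qed

text \<open>The glued polytope is compact, so its support is everything and only the solution
  property remains. Generic functionals at a vertex of the value select some \<open>v\<close> in
  \<open>M\<close> and \<gamma> in the polytope; by (P), \<gamma> is a vertex of \<open>S v\<close>,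
  from which the repeated vertex is transferred.\<close>

lemma glued_global_solution:
  assumes \<phi>: "pointed_polynomial \<phi>"
    and S: "\<And>v. v \<in> vertices (coeff_sum \<phi>) \<Longrightarrow> complete_local_solution \<phi> v (S v)"
    and comp: "compatible \<phi> S"
  shows "polytope (glued \<phi> S) \<and> global_solution \<phi> (glued \<phi> S)"
proof -
  let ?M = "coeff_sum \<phi>" and ?G = "glued \<phi> S"
  have M: "polyhedron ?M" "vertices ?M \<noteq> {}" and card: "2 \<le> card (Supp \<phi>)"
    using \<phi> by (auto simp: pointed_polynomial_def)
  have sol: "solution \<phi> (S v)" and NS: "normal_support (S v) = normal_cone ?M v"
    if "v \<in> vertices ?M" for v
    using S[OF that] by (auto simp: complete_local_solution_def local_solution_def)
  have Sv: "polyhedron (S v)" "vertices (S v) \<noteq> {}" if "v \<in> vertices ?M" for v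
    using sol[OF that] by (auto simp: solution_def)
  have subG: "vertices (S v) \<subseteq> ?G" if "v \<in> vertices ?M" for v
    unfolding glued_def using that by (auto intro: hull_inc)
  have "finite (\<Union>v\<in>vertices ?M. vertices (S v))"
    using finite_vertices[OF M(1)] finite_vertices[OF Sv(1)] by blast
  then have G: "polytope ?G" unfolding glued_def by (rule polytope_convex_hull)
  have Gp: "polyhedron ?G" by (rule polytope_imp_polyhedron[OF G])
  have "?G \<noteq> {}" using M(2) Sv(2) subG by fastforce
  then have VG: "vertices ?G \<noteq> {}"
    using extreme_point_exists_convex[OF polytope_imp_compact[OF G] polytope_imp_convex[OF G]]
    by (auto simp: vertices_def)
  have bddG: "bdd_below ((\<bullet>) l ` ?G)" for l
    using polytope_imp_compact[OF G]
    by (intro bounded_imp_bdd_below compact_imp_bounded compact_continuous_image continuous_intros)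
  then have NG: "normal_support ?G = UNIV" by (simp add: normal_support_eq[OF Gp VG])
  have "\<exists>i\<in>Supp \<phi>. \<exists>j\<in>Supp \<phi>. i \<noteq> j \<and>
      w \<in> vertices (summand \<phi> ?G i) \<and> w \<in> vertices (summand \<phi> ?G j)"
    if w: "w \<in> vertices (poly_value \<phi> ?G)" for w
  proof -
    let ?U = "interior (normal_cone (poly_value \<phi> ?G) w)"
    obtain v0 where v0: "v0 \<in> vertices ?M" using M(2) by blast
    have "normal_cone ?M v0 \<subseteq> normal_support ?G \<inter> normal_support ?M"
      unfolding NG using v0 by (auto simp: normal_support_def)
    from interior_mono[OF this] have "interior (normal_support ?G \<inter> normal_support ?M) \<noteq> {}"
      using interior_normal_cone_vertex[OF M(1) v0] by blast
    then have ne: "?U \<noteq> {}"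
      by (rule interior_normal_cone_poly_value[OF \<phi> Gp VG _ w])
    \<comment> \<open>Boundedness on the value passes to every coefficient and hence to
      \<open>M\<close>, so these functionals select a vertex of \<open>M\<close>.\<close>
    have bdd: "bdd_below ((\<bullet>) l ` ?M)" if "l \<in> ?U" for l
    proof (rule normal_support_bdd_below)
      have "bdd_below ((\<bullet>) l ` poly_value \<phi> ?G)"
        by (rule normal_cone_bdd_below[OF subsetD[OF interior_subset that]])
      then show "l \<in> normal_support ?M"
        using poly_value_bdd_below(2)[OF _ card \<open>?G \<noteq> {}\<close>] by (simp add: normal_support_coeff_sum[OF \<phi>])
    qed
    obtain v U where U: "v \<in> vertices ?M" "open U" "U \<noteq> {}" "U \<subseteq> ?U" "U \<subseteq> normal_cone ?M v"
      by (rule open_subset_normal_cone_vertex[OF M open_interior ne bdd])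
    obtain \<gamma> V where V: "\<gamma> \<in> vertices ?G" "open V" "V \<noteq> {}" "V \<subseteq> U" "V \<subseteq> normal_cone ?G \<gamma>"
      by (rule open_subset_normal_cone_vertex[OF Gp VG U(2,3) bddG])
    have "V \<subseteq> interior (normal_cone ?M v \<inter> normal_cone ?G \<gamma>)"
      using U V by (intro interior_maximal) auto
    then have "full_dimensional (normal_cone ?M v \<inter> normal_cone ?G \<gamma>)"
      using V(3) full_dimensional_iff_interior[OF convex_Int[OF convex_normal_cone convex_normal_cone]]
      by blast
    then have \<gamma>S: "\<gamma> \<in> vertices (S v)" using comp U(1) V(1) by (auto simp: compatible_def)
    \<comment> \<open>Completeness of \<open>S v\<close> provides a minimiser among its vertices.
      That vertex lies in the glued polytope, so \<gamma> does at least as well.\<close>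
    have "V \<subseteq> normal_cone (S v) \<gamma>"
    proof
      fix l assume l: "l \<in> V"
      then have "l \<in> normal_support (S v)" using NS[OF U(1)] U V by blast
      then obtain \<gamma>' where \<gamma>': "\<gamma>' \<in> vertices (S v)" "l \<in> normal_cone (S v) \<gamma>'"
        by (auto simp: normal_support_def)
      then have "l \<bullet> \<gamma> \<le> l \<bullet> \<gamma>'" using l V(5) subG[OF U(1)] by (auto simp: normal_cone_def)
      with \<gamma>'(2) show "l \<in> normal_cone (S v) \<gamma>" by (auto simp: normal_cone_def intro: order_trans)
    qed
    moreover have "V \<subseteq> normal_cone (poly_value \<phi> ?G) w"
      using V(4) U(4) interior_subset[of "normal_cone (poly_value \<phi> ?G) w"] by blast
    moreover have "\<gamma> \<in> S v" "\<gamma> \<in> ?G" "w \<in> poly_value \<phi> ?G"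
      using \<gamma>S V(1) w vertices_subset by blast+
    ultimately show ?thesis
      using V by (intro solution_vertex_transfer[OF \<phi> sol[OF U(1)]])
  qed
  then show ?thesis
    using G Gp VG NG by (simp add: global_solution_def solution_def)
qed

theorem theorem1p2:
  fixes \<omega> :: "real ^ 'n" and A :: "(real ^ 'n) set set" and \<phi> :: "nat \<Rightarrow> (real ^ 'n) set"
  assumes "rationally_independent \<omega>"
    and "polyhedral_semiring \<omega> A"
    and "polyhedral_polynomial A \<phi>"
  shows "((\<exists>P. global_solution \<phi> P) \<longleftrightarrow>
          (\<exists>S. (\<forall>v\<in>vertices (coeff_sum \<phi>). complete_local_solution \<phi> v (S v)) \<and>
               compatible \<phi> S)) \<and>
         (\<forall>S. (\<forall>v\<in>vertices (coeff_sum \<phi>). complete_local_solution \<phi> v (S v)) \<and>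
               compatible \<phi> S \<longrightarrow>
               polytope (glued \<phi> S) \<and> global_solution \<phi> (glued \<phi> S))"
proof -
  have \<phi>: "pointed_polynomial \<phi>"
    by (rule polyhedral_polynomial_pointed[OF assms])
  have glue: "polytope (glued \<phi> S) \<and> global_solution \<phi> (glued \<phi> S)"
    if "(\<forall>v\<in>vertices (coeff_sum \<phi>). complete_local_solution \<phi> v (S v)) \<and> compatible \<phi> S" for S
    using that by (intro glued_global_solution[OF \<phi>]) auto
  have "\<exists>S. (\<forall>v\<in>vertices (coeff_sum \<phi>). complete_local_solution \<phi> v (S v)) \<and> compatible \<phi> S"
    if P: "global_solution \<phi> P" for P
  proof -
    have "\<forall>v\<in>vertices (coeff_sum \<phi>). \<exists>S. complete_local_solution \<phi> v S \<and>
        vertices P \<subseteq> S \<and> vertices S \<subseteq> vertices P"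
      using complete_local_solution_from_global[OF \<phi> P] by metis
    then obtain S where S: "\<forall>v\<in>vertices (coeff_sum \<phi>). complete_local_solution \<phi> v (S v) \<and>
        vertices P \<subseteq> S v \<and> vertices (S v) \<subseteq> vertices P"
      by (rule bchoice[THEN exE])
    \<comment> \<open>The same vertex set, that of \<open>P\<close>, bounds all the
      \<open>S v\<close>; this common bound is what gives property (P).\<close>
    then have "compatible \<phi> S"
      by (intro compatible_from_global[of \<phi> S "vertices P"]) auto
    with S show ?thesis by blast
  qed
  with glue show ?thesis by blast
qed

end
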